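(* Let $0<a<b<1$ and $\varrho\ge0$ a function on $[a,b]$ with $\varrho/\zeta$ non-decreasing and bounded. Let $w\in C^{0,1}([a,b])$ and $\lambda\in\mathbb{R}$ satisfy $$w'+\lambda\zeta w^2=\Big(\tfrac1x+\widetilde\varrho\Big)w\ \text{ a.e. on }(a,b),\qquad w(a)=w(b)=1,$$ and assume $w>1$ on $(a,b)$. Let $w_0(x)=\frac{(a+b)x}{x^2+ab}$ and $T:=\min\{\|w_0\|_\infty,\|w\|_\infty\}$. Then (i) $\mu_w(t)\le\mu_{w_0}(t)$ for every $t\in[1,T)$; (ii) $\|w\|_\infty\le\|w_0\|_\infty$; (iii) if $\varrho\not\equiv0$ on $[a,b)$, there exists $t_0\in(1,\|w\|_\infty)$ such that $\mu_w(t)<\mu_{w_0}(t)$ for every $t\in(1,t_0)$.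
   Context: $\zeta(t)=\frac2{1-t^2}$, $\widetilde\varrho(t)=t\zeta(t)+\varrho(t)$. $\mu$ is the measure $dx/x$ on $(0,\infty)$ and $\mu_w(t):=\mu(\{x\in[a,b]:w(x)>t\})$. Note $w_0$ is the solution of the same problem when $\varrho\equiv0$. *)

theory Defs
  imports "HOL-Analysis.Analysis"
begin

definition zeta :: "real \<Rightarrow> real" where
  "zeta t = 2 / (1 - t^2)"

definition rho_tilde :: "(real \<Rightarrow> real) \<Rightarrow> real \<Rightarrow> real" where
  "rho_tilde \<rho> t = t * zeta t + \<rho> t"

definition mu :: "real measure" where
  "mu = density lborel (\<lambda>x. ennreal (if 0 < x then 1 / x else 0))"

definition mu_fun :: "real \<Rightarrow> real \<Rightarrow> (real \<Rightarrow> real) \<Rightarrow> real \<Rightarrow> real" where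
  "mu_fun a b w t = measure mu {x \<in> {a..b}. w x > t}"

text \<open>Sup norm on [a,b] (w is continuous, so this is the L-infinity norm).\<close>
definition supnorm :: "real \<Rightarrow> real \<Rightarrow> (real \<Rightarrow> real) \<Rightarrow> real" where
  "supnorm a b f = (SUP x\<in>{a..b}. \<bar>f x\<bar>)"

definition w0 :: "real \<Rightarrow> real \<Rightarrow> real \<Rightarrow> real" where
  "w0 a b x = (a + b) * x / (x^2 + a * b)"

end

(*
  Put g = rho / zeta, N(t) = mu_w(t) and Phi(t) = t cosh (N(t) / 2).  For w_0 the superlevel sets are
  intervals symmetric about sqrt(ab) in the variable ln x, and Phi is constant, equal to
  C = (a + b) / (2 sqrt(ab)).  For w one shows that Phi is non-increasing with Phi(1) = C.

  If (x1, x2) is a component of {w > t}, the slopes of w at its ends, in the variable ln x, are t X and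
  -t Y, so N drops at rate at least (1/X + 1/Y) / t.  With tau = (x2 - x1) / (x2 + x1) <= tanh (N / 2),
  monotonicity of Phi follows once the harmonic mean of X and Y is at most tau.  In terms of
  p_i = lam t - g(x_i), where p_2 <= p_1 since g is monotone, X and Y are affine, and both equal tau when
  p_1 = p_2 = p0, the constant of the problem with rho = 0 on [x1, x2].  Comparing 1/w with the solution
  of that problem gives p_2 <= p0, strictly if g is not zero on (x1, x2), and then the bound is algebra.
*)
theory Submission
  imports Defs
begin

text \<open>\<open>w\<close> is merely Lipschitz, its equation holds almost everywhere and
  \<open>g\<close> may jump, so nothing guarantees that \<open>N\<close> is continuous or
  differentiable. All rates are therefore one-sided inequalities: the slopes of \<open>w\<close> at
  the ends of a component come from freezing \<open>g\<close> near a one-sided limit, and the decay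
  of \<open>\<Phi>\<close> from comparing \<open>\<Phi> t\<close> with
  \<open>\<Phi> (t + \<delta>)\<close> for small \<open>\<delta> > 0\<close>. Downward jumps of
  \<open>N\<close> only help. Formally
  \<open>\<Phi>' = cosh (N / 2) + t N' sinh (N / 2) / 2\<close>, and
  \<open>t N' <= - (1/X + 1/Y) <= - 2 / \<tau>\<close> makes this at most
  \<open>cosh (N / 2) - sinh (N / 2) / \<tau> <= 0\<close>. One component per level suffices:
  further ones only speed up the drop and enlarge \<open>N\<close>, and both effects go the right
  way. As \<open>X\<close> or \<open>Y\<close> may vanish, the harmonic bound is stated without
  division and the slopes are perturbed by \<open>e > 0\<close>. The bound on the sup norm comes
  from the same monotonicity, since \<open>cosh >= 1\<close>.\<close>

section \<open>Lipschitz functions and one-sided growth\<close>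

text \<open>Zygmund's argument: a value missed by the null set of bad points is last attained at a point where
  the derivative has the wrong sign.\<close>

lemma lipschitz_AE_deriv_nonneg_imp_le:
  fixes f :: "real \<Rightarrow> real"
  assumes lip: "L-lipschitz_on {c..d} f" and "c \<le> d"
    and ae: "AE x in lborel. x \<in> {c<..<d} \<longrightarrow> (\<exists>D\<ge>0. (f has_real_derivative D) (at x))"
  shows "f c \<le> f d"
proof (rule ccontr)
  assume less: "\<not> f c \<le> f d"
  then have "c < d"
    using \<open>c \<le> d\<close> by (cases "c = d") auto
  \<comment> \<open>Half the mean rate of descent: the tilted \<open>q\<close> still ends below its
    start, but wherever \<open>f\<close> has derivative at least 0, \<open>q\<close> has a strictly
    positive one.\<close>
  define e where "e = (f c - f d) / 2 / (d - c)"
  have "e > 0"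
    using less \<open>c < d\<close> by (simp add: e_def)
  define q where "q = (\<lambda>x. f x + e * x)"
  have "q d < q c"
  proof -
    have "e * (d - c) = (f c - f d) / 2"
      using \<open>c < d\<close> e_def by (simp add: eq_divide_eq algebra_simps)
    then show ?thesis
      using less by (simp add: q_def algebra_simps)
  qed
  have qlip: "(L + e)-lipschitz_on {c..d} q"
    unfolding q_def using \<open>e > 0\<close> lipschitz_on_add[OF lip lipschitz_on_cmult_real_nonneg[OF lipschitz_on_id, of e]]
    by simp
  then have qcont: "continuous_on {c..d} q"
    by (rule lipschitz_on_continuous_on)
  define E where "E = {x \<in> {c<..<d}. \<not> (\<exists>D\<ge>0. (f has_real_derivative D) (at x))}"
  have "negligible E"
  proof -
    obtain N where "N \<in> null_sets lborel" "{x \<in> space lborel. \<not> (x \<in> {c<..<d} \<longrightarrow> (\<exists>D\<ge>0. (f has_real_derivative D) (at x)))} \<subseteq> N"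
      using ae unfolding eventually_ae_filter by auto
    then have "negligible N" "E \<subseteq> N"
      by (auto simp: negligible_iff_null_sets null_sets_completionI E_def)
    then show ?thesis
      by (rule negligible_subset)
  qed
  have "negligible (q ` E)"
  proof (rule negligible_locally_Lipschitz_image[OF _ \<open>negligible E\<close>])
    fix x assume "x \<in> E"
    then show "\<exists>T B. open T \<and> x \<in> T \<and> (\<forall>y\<in>E \<inter> T. norm (q y - q x) \<le> B * norm (y - x))"
      using qlip by (intro exI[of _ UNIV] exI[of _ "L + e"])
        (auto simp: E_def lipschitz_on_def dist_norm)
  qed simp
  moreover have "\<not> negligible {q d<..<q c}"
    using \<open>q d < q c\<close> negligible_interval(2)[of "q d" "q c"] by simp
  ultimately obtain y where y: "q d < y" "y < q c" "y \<notin> q ` E"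
    using negligible_subset by (metis greaterThanLessThan_iff subsetI)
  define S where "S = {x \<in> {c..d}. q x \<ge> y}"
  have "closed S"
    unfolding S_def using qcont by (intro continuous_on_closed_Collect_le continuous_intros) auto
  moreover have "c \<in> S" "bdd_above S"
    using y \<open>c < d\<close> by (auto simp: S_def)
  ultimately have s: "Sup S \<in> S"
    using closed_contains_Sup[of S] by auto
  define s where "s = Sup S"
  have "s < d"
    using s y by (auto simp: S_def s_def order_less_le)
  have after: "q x < y" if "s < x" "x \<le> d" for x
  proof (rule ccontr)
    assume "\<not> q x < y"
    then have "x \<in> S" using that s by (auto simp: S_def s_def)
    then have "x \<le> s" using \<open>bdd_above S\<close> by (auto simp: s_def intro: cSup_upper)
    then show False using that by simp
  qed
  have "q s = y"
  proof (rule antisym)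
    show "y \<le> q s" using s by (simp add: S_def s_def)
    show "q s \<le> y"
    proof (rule tendsto_upperbound)
      have "(q \<longlongrightarrow> q s) (at s within {s..d})"
        using qcont s \<open>s < d\<close> unfolding continuous_on_def
        by (auto simp: S_def s_def intro: tendsto_within_subset[where S = "{c..d}"])
      then show "(q \<longlongrightarrow> q s) (at_right s)"
        using \<open>s < d\<close> by (simp add: at_within_Icc_at_right)
      show "eventually (\<lambda>x. q x \<le> y) (at_right s)"
        using \<open>s < d\<close> after by (auto simp: eventually_at_right intro: less_imp_le intro!: exI[of _ d])
    qed simp
  qed
  then have "c < s"
    using y s by (auto simp: S_def s_def order_less_le)
  then have "s \<notin> E" "s \<in> {c<..<d}"
    using y \<open>q s = y\<close> \<open>s < d\<close> by auto
  then obtain D where "D \<ge> 0" "(f has_real_derivative D) (at s)"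
    by (auto simp: E_def)
  then have "(q has_real_derivative D + e) (at s)"
    unfolding q_def by (auto intro!: derivative_eq_intros)
  from DERIV_pos_inc_right[OF this] \<open>D \<ge> 0\<close> \<open>e > 0\<close>
  obtain \<delta> where \<delta>: "\<delta> > 0" "\<And>h. h > 0 \<Longrightarrow> h < \<delta> \<Longrightarrow> q s < q (s + h)"
    by force
  define h where "h = min (\<delta> / 2) (d - s)"
  have "h > 0" "h < \<delta>" "s + h \<le> d"
    using \<delta>(1) \<open>s < d\<close> by (auto simp: h_def)
  with \<delta>(2)[of h] after[of "s + h"] \<open>q s = y\<close> show False
    by auto
qed

lemma lipschitz_on_mult:
  fixes f g :: "real \<Rightarrow> real"
  assumes f: "K-lipschitz_on S f" and g: "L-lipschitz_on S g"
    and "\<And>x. x \<in> S \<Longrightarrow> \<bar>f x\<bar> \<le> M" "\<And>x. x \<in> S \<Longrightarrow> \<bar>g x\<bar> \<le> N" "M \<ge> 0" "N \<ge> 0"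
  shows "(M * L + K * N)-lipschitz_on S (\<lambda>x. f x * g x)"
proof (rule lipschitz_onI)
  fix x y assume xy: "x \<in> S" "y \<in> S"
  have "f x * g x - f y * g y = f x * (g x - g y) + (f x - f y) * g y"
    by (simp add: algebra_simps)
  then have "\<bar>f x * g x - f y * g y\<bar> \<le> \<bar>f x\<bar> * \<bar>g x - g y\<bar> + \<bar>f x - f y\<bar> * \<bar>g y\<bar>"
    by (metis abs_mult abs_triangle_ineq)
  also have "\<dots> \<le> M * (L * \<bar>x - y\<bar>) + (K * \<bar>x - y\<bar>) * N"
    using assms xy lipschitz_onD[OF f xy] lipschitz_onD[OF g xy] lipschitz_on_nonneg[OF f]
    by (intro add_mono mult_mono) (auto simp: dist_real_def)
  finally show "dist (f x * g x) (f y * g y) \<le> (M * L + K * N) * dist x y"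
    by (simp add: dist_real_def algebra_simps)
qed (use assms lipschitz_on_nonneg[OF f] lipschitz_on_nonneg[OF g] in auto)

lemma lipschitz_on_mult_Icc:
  fixes f g :: "real \<Rightarrow> real"
  assumes f: "K-lipschitz_on {c..d} f" and g: "L-lipschitz_on {c..d} g"
  shows "\<exists>M. M-lipschitz_on {c..d} (\<lambda>x. f x * g x)"
proof -
  have "\<exists>B\<ge>0. \<forall>x\<in>{c..d}. \<bar>h x\<bar> \<le> B" if "M-lipschitz_on {c..d} h" for M and h :: "real \<Rightarrow> real"
  proof -
    have "bounded (h ` {c..d})"
      using lipschitz_on_continuous_on[OF that] by (intro compact_imp_bounded compact_continuous_image) auto
    then show ?thesis
      unfolding bounded_pos by (auto intro: less_imp_le)
  qed
  from this[OF f] this[OF g] obtain B B'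
    where "\<And>x. x \<in> {c..d} \<Longrightarrow> \<bar>f x\<bar> \<le> B" "\<And>x. x \<in> {c..d} \<Longrightarrow> \<bar>g x\<bar> \<le> B'" "0 \<le> B" "0 \<le> B'"
    by blast
  then show ?thesis
    using lipschitz_on_mult[OF f g] by blast
qed

lemma C1_imp_lipschitz_on_Icc:
  fixes f f' :: "real \<Rightarrow> real"
  assumes der: "\<And>x. x \<in> {c..d} \<Longrightarrow> (f has_real_derivative f' x) (at x)"
    and cont: "continuous_on {c..d} f'"
  shows "\<exists>L. L-lipschitz_on {c..d} f"
proof -
  have "bounded (f' ` {c..d})"
    using cont by (intro compact_imp_bounded compact_continuous_image) auto
  then obtain B where B: "B > 0" "\<And>x. x \<in> {c..d} \<Longrightarrow> \<bar>f' x\<bar> \<le> B"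
    unfolding bounded_pos by auto
  have "B-lipschitz_on {c..d} f"
  proof (rule lipschitz_onI)
    fix x y assume xy: "x \<in> {c..d}" "y \<in> {c..d}"
    have "(f has_field_derivative f' z) (at z within {c..d})" if "z \<in> {c..d}" for z
      using der[OF that] by (rule has_field_derivative_at_within)
    then have "norm (f x - f y) \<le> B * norm (x - y)"
      using B(2) xy by (intro field_differentiable_bound[of "{c..d}" f f' B x y]) simp_all
    then show "dist (f x) (f y) \<le> B * dist x y"
      unfolding dist_norm .
  qed (use B in auto)
  then show ?thesis ..
qed

text \<open>Continuous induction for a function that may jump down: \<open>left\<close> excludes
  upward jumps, so the supremum of the good set is good, and \<open>right\<close> pushes past it.
  The size of \<open>K\<close> does not enter the conclusion.\<close>

lemma right_local_growth_imp_le: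
  fixes f :: "real \<Rightarrow> real"
  assumes "c \<le> d" "K \<ge> 0"
    and left: "\<And>r s. c \<le> r \<Longrightarrow> r \<le> s \<Longrightarrow> s \<le> d \<Longrightarrow> f s \<le> f r + K * (s - r)"
    and right: "\<And>s \<eta>. c \<le> s \<Longrightarrow> s < d \<Longrightarrow> \<eta> > 0 \<Longrightarrow> \<forall>\<^sub>F \<delta> in at_right 0. f (s + \<delta>) \<le> f s + \<eta> * \<delta>"
  shows "f d \<le> f c"
proof (rule field_le_epsilon)
  fix e :: real assume "e > 0"
  \<comment> \<open>The total rise \<open>\<eta> * (d - c)\<close> stays below \<open>e\<close>; the
    summand 1 covers \<open>c = d\<close>.\<close>
  define \<eta> where "\<eta> = e / (d - c + 1)"
  have "\<eta> > 0" using \<open>e > 0\<close> \<open>c \<le> d\<close> by (simp add: \<eta>_def)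
  define S where "S = {s \<in> {c..d}. f s \<le> f c + \<eta> * (s - c)}"
  have S: "c \<in> S" "bdd_above S"
    using \<open>c \<le> d\<close> by (auto simp: S_def)
  define s where "s = Sup S"
  have "x \<le> d" if "x \<in> S" for x
    using that by (simp add: S_def)
  then have s: "c \<le> s" "s \<le> d"
    unfolding s_def using S by (blast intro: cSup_upper cSup_least)+
  have "f s \<le> f c + \<eta> * (s - c)"
  proof (rule field_le_epsilon)
    fix \<epsilon> :: real assume "\<epsilon> > 0"
    have "s - \<epsilon> / (K + 1) < s" using \<open>\<epsilon> > 0\<close> \<open>K \<ge> 0\<close> by simp
    then obtain r where r: "r \<in> S" "s - \<epsilon> / (K + 1) < r"
      unfolding s_def using S less_cSup_iff[of S] by blast
    then have "r \<le> s" using S by (auto simp: s_def intro: cSup_upper)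
    have "K * (s - r) \<le> (K + 1) * (s - r)" using \<open>r \<le> s\<close> by (simp add: algebra_simps)
    also have "\<dots> \<le> \<epsilon>" using r \<open>K \<ge> 0\<close> by (simp add: field_simps)
    finally have "K * (s - r) \<le> \<epsilon>" .
    moreover have "\<eta> * (r - c) \<le> \<eta> * (s - c)" using \<open>r \<le> s\<close> \<open>\<eta> > 0\<close> by simp
    moreover have "f s \<le> f r + K * (s - r)" using left[of r s] r \<open>r \<le> s\<close> s by (auto simp: S_def)
    ultimately show "f s \<le> f c + \<eta> * (s - c) + \<epsilon>" using r by (auto simp: S_def)
  qed
  moreover have "s = d"
  proof (rule ccontr)
    assume "s \<noteq> d"
    then have "s < d" using s by simp
    have "\<forall>\<^sub>F \<delta> in at_right 0. f (s + \<delta>) \<le> f s + \<eta> * \<delta> \<and> 0 < \<delta> \<and> \<delta> < d - s"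
      using right[OF s(1) \<open>s < d\<close> \<open>\<eta> > 0\<close>] eventually_at_right_real[of 0 "d - s"] \<open>s < d\<close>
      by (auto elim: eventually_elim2)
    then obtain \<delta> where \<delta>: "f (s + \<delta>) \<le> f s + \<eta> * \<delta>" "0 < \<delta>" "\<delta> < d - s"
      using eventually_happens'[OF trivial_limit_at_right_real] by blast
    with \<open>f s \<le> f c + \<eta> * (s - c)\<close> s have "s + \<delta> \<in> S"
      by (auto simp: S_def algebra_simps)
    then have "s + \<delta> \<le> s" unfolding s_def using S(2) by (rule cSup_upper)
    then show False using \<delta> by simp
  qed
  moreover have "\<eta> * (d - c) \<le> e"
    using \<open>e > 0\<close> \<open>c \<le> d\<close> by (simp add: \<eta>_def field_simps)
  ultimately show "f d \<le> f c + e" by simp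
qed

section \<open>The measure dx/x\<close>

lemma sets_mu [simp, measurable_cong]: "sets mu = sets borel"
  by (simp add: mu_def)

text \<open>Endpoints are null, so one statement serves the open, closed and half-open intervals
  below.\<close>

lemma emeasure_mu_interval:
  assumes "0 < c" "c \<le> d" and S: "S \<in> sets borel" "{c<..<d} \<subseteq> S" "S \<subseteq> {c..d}"
  shows "emeasure mu S = ennreal (ln (d / c))"
proof -
  have "emeasure mu S = (\<integral>\<^sup>+x. ennreal (if 0 < x then 1 / x else 0) * indicator S x \<partial>lborel)"
    unfolding mu_def using S by (intro emeasure_density) auto
  also have "\<dots> = (\<integral>\<^sup>+x. ennreal (1 / x) * indicator {c..d} x \<partial>lborel)"
  proof (rule nn_integral_cong_AE)
    show "AE x in lborel. ennreal (if 0 < x then 1 / x else 0) * indicator S x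
        = ennreal (1 / x) * indicator {c..d} x"
      using AE_lborel_singleton[of c] AE_lborel_singleton[of d]
    proof eventually_elim
      case (elim x)
      then have "x \<in> S \<longleftrightarrow> x \<in> {c..d}"
        using S by (auto simp: subset_iff)
      then show ?case
        using \<open>0 < c\<close> by (auto simp: indicator_def)
    qed
  qed
  also have "\<dots> = ennreal (ln d - ln c)"
    using assms(1,2)
    by (intro nn_integral_FTC_Icc) (auto intro!: derivative_eq_intros simp: has_real_derivative_iff_has_vector_derivative[symmetric])
  finally show ?thesis
    using assms(1,2) by (simp add: ln_div)
qed

lemma measure_mu_interval:
  assumes "0 < c" "c \<le> d" "S \<in> sets borel" "{c<..<d} \<subseteq> S" "S \<subseteq> {c..d}"
  shows "measure mu S = ln (d / c)"
  using emeasure_mu_interval[OF assms] assms(1,2) by (simp add: measure_def)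

lemma fmeasurable_mu:
  assumes "0 < a" "S \<in> sets borel" "S \<subseteq> {a..b}"
  shows "S \<in> fmeasurable mu"
proof (cases "a \<le> b")
  case True
  then have "{a..b} \<in> fmeasurable mu"
    using emeasure_mu_interval[of a b "{a..b}"] \<open>0 < a\<close>
    by (intro fmeasurableI) (simp_all add: greaterThanLessThan_subseteq_atLeastAtMost_iff)
  then show ?thesis
    using assms by (rule_tac fmeasurableI2) auto
qed (use assms in auto)

lemma superlevel_set_borel:
  fixes w :: "real \<Rightarrow> real"
  assumes "continuous_on {a..b} w"
  shows "{x \<in> {a..b}. w x > t} \<in> sets borel"
proof -
  have "{x \<in> {a..b}. w x > t} = {a..b} - {x \<in> {a..b}. w x \<le> t}"
    by auto
  moreover have "closed {x \<in> {a..b}. w x \<le> t}"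
    using assms by (intro continuous_on_closed_Collect_le continuous_intros) auto
  ultimately show ?thesis
    by auto
qed

lemma mu_fun_antimono:
  assumes "0 < a" "continuous_on {a..b} w" "s \<le> t"
  shows "mu_fun a b w t \<le> mu_fun a b w s"
  unfolding mu_fun_def using assms
  by (intro measure_mono_fmeasurable fmeasurable_mu[of a _ b])
    (auto simp: superlevel_set_borel[simplified] subset_iff)

lemma mu_fun_ge_interval:
  assumes "0 < a" "continuous_on {a..b} w" "a \<le> c" "c \<le> d" "d \<le> b"
    and "\<And>x. c < x \<Longrightarrow> x < d \<Longrightarrow> w x > t"
  shows "ln (d / c) \<le> mu_fun a b w t"
proof -
  have "measure mu {c<..<d} \<le> mu_fun a b w t"
    unfolding mu_fun_def using assms
    by (intro measure_mono_fmeasurable fmeasurable_mu[of a _ b])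
      (auto simp: superlevel_set_borel[simplified] subset_iff)
  then show ?thesis
    using measure_mu_interval[of c d "{c<..<d}"] assms
    by (simp add: greaterThanLessThan_subseteq_atLeastAtMost_iff)
qed

text \<open>The two end strips lie above level \<open>t\<close> but not above \<open>s\<close>, so
  passing from \<open>t\<close> to \<open>s\<close> loses at least their measure. Whatever else is
  lost is discarded.\<close>

lemma mu_fun_drop:
  assumes "0 < a" "continuous_on {a..b} w" "t \<le> s"
    and "a \<le> c" "c \<le> c'" "c' < d'" "d' \<le> d" "d \<le> b"
    and above: "\<And>x. c < x \<Longrightarrow> x < d \<Longrightarrow> w x > t"
    and left: "\<And>x. c < x \<Longrightarrow> x \<le> c' \<Longrightarrow> w x \<le> s"
    and right: "\<And>x. d' \<le> x \<Longrightarrow> x < d \<Longrightarrow> w x \<le> s"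
  shows "mu_fun a b w s + (ln (c' / c) + ln (d / d')) \<le> mu_fun a b w t"
proof -
  define A where "A = {x \<in> {a..b}. w x > s}"
  let ?B = "{c<..c'}" and ?C = "{d'..<d}"
  have [simp]: "A \<in> sets borel"
    unfolding A_def by (rule superlevel_set_borel[OF assms(2)])
  have fin: "A \<in> fmeasurable mu" "?B \<in> fmeasurable mu" "?C \<in> fmeasurable mu"
  proof -
    have "A \<subseteq> {a..b}" "?B \<subseteq> {a..b}" "?C \<subseteq> {a..b}"
      using \<open>a \<le> c\<close> \<open>c \<le> c'\<close> \<open>c' < d'\<close> \<open>d' \<le> d\<close> \<open>d \<le> b\<close>
      by (auto simp: A_def)
    then show "A \<in> fmeasurable mu" "?B \<in> fmeasurable mu" "?C \<in> fmeasurable mu"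
      by (simp_all add: fmeasurable_mu[OF \<open>0 < a\<close>, where b = b])
  qed
  have "?B \<inter> ?C = {}"
    using \<open>c' < d'\<close> by auto
  have "A \<inter> (?B \<union> ?C) = {}"
  proof -
    have "\<not> w x > s" if "x \<in> ?B \<union> ?C" for x
      using that left[of x] right[of x] by auto
    then show ?thesis by (auto simp: A_def)
  qed
  then have "measure mu (A \<union> (?B \<union> ?C)) = measure mu A + measure mu (?B \<union> ?C)"
    using fin by (intro measure_Union) (simp_all add: fmeasurableD fmeasurableD2 fmeasurable.Un)
  also have "measure mu (?B \<union> ?C) = measure mu ?B + measure mu ?C"
    using fin \<open>?B \<inter> ?C = {}\<close> by (intro measure_Union) (simp_all add: fmeasurableD fmeasurableD2)
  also have "measure mu ?B = ln (c' / c)"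
    using \<open>0 < a\<close> \<open>a \<le> c\<close> \<open>c \<le> c'\<close> by (intro measure_mu_interval) auto
  also have "measure mu ?C = ln (d / d')"
    using \<open>0 < a\<close> \<open>a \<le> c\<close> \<open>c \<le> c'\<close> \<open>c' < d'\<close> \<open>d' \<le> d\<close> by (intro measure_mu_interval) auto
  finally have "measure mu (A \<union> (?B \<union> ?C)) = mu_fun a b w s + (ln (c' / c) + ln (d / d'))"
    by (simp add: mu_fun_def A_def)
  moreover have "measure mu (A \<union> (?B \<union> ?C)) \<le> mu_fun a b w t"
    unfolding mu_fun_def
  proof (intro measure_mono_fmeasurable fmeasurable_mu[of a _ b])
    have "x \<in> {a..b} \<and> w x > t" if "x \<in> ?B \<union> ?C" for x
      using that above[of x] \<open>a \<le> c\<close> \<open>c \<le> c'\<close> \<open>c' < d'\<close> \<open>d' \<le> d\<close> \<open>d \<le> b\<close> by auto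
    then show "A \<union> (?B \<union> ?C) \<subseteq> {x \<in> {a..b}. w x > t}"
      using \<open>t \<le> s\<close> by (force simp: A_def)
    show "A \<union> (?B \<union> ?C) \<in> sets mu"
      by (simp add: sets.Un)
    show "{x \<in> {a..b}. w x > t} \<in> sets borel"
      by (rule superlevel_set_borel[OF assms(2)])
  qed (use \<open>0 < a\<close> in auto)
  ultimately show ?thesis by simp
qed

section \<open>The harmonic mean inequality\<close>

text \<open>The values \<open>p0\<close> and \<open>\<tau>\<close> are those for which
  \<open>X = \<tau> + B * (p0 - p1)\<close> and \<open>Y = \<tau> - B' * (p0 - p2)\<close>. Thus
  \<open>Y <= \<tau>\<close>. If also \<open>X <= \<tau>\<close>, the claim is a sum of nonnegative
  products; otherwise the excess of \<open>X\<close> is outweighed by the deficit of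
  \<open>Y\<close>, because \<open>B < B'\<close> and \<open>p2 <= p1\<close>.\<close>

lemma harmonic_mean_le:
  fixes x y p1 p2 :: real
  defines "X \<equiv> (1 + x\<^sup>2) / (1 - x\<^sup>2) - 2 * x / (1 - x\<^sup>2) * p1"
    and "Y \<equiv> 2 * y / (1 - y\<^sup>2) * p2 - (1 + y\<^sup>2) / (1 - y\<^sup>2)"
    and "p0 \<equiv> (1 + x * y) / (x + y)" and "\<tau> \<equiv> (y - x) / (y + x)"
  assumes xy: "0 < x" "x < y" "y < 1" and p: "p2 \<le> p1" "p2 \<le> p0" and nn: "X \<ge> 0" "Y \<ge> 0"
  shows "2 * X * Y \<le> \<tau> * (X + Y)"
    and "p2 < p0 \<Longrightarrow> X \<noteq> 0 \<or> Y \<noteq> 0 \<Longrightarrow> 2 * X * Y < \<tau> * (X + Y)"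
proof -
  define B where "B = 2 * x / (1 - x\<^sup>2)"
  define B' where "B' = 2 * y / (1 - y\<^sup>2)"
  have sq: "x\<^sup>2 < 1" "y\<^sup>2 < 1" "x\<^sup>2 < y\<^sup>2"
    using xy by (simp_all add: power_strict_mono power_less_one_iff)
  have B: "0 < B" "0 < B'" "B < B'"
    using xy sq unfolding B_def B'_def by (simp_all add: frac_less)
  have "\<tau> > 0" using xy by (simp add: \<tau>_def)
  have eX: "(1 + x\<^sup>2) / (1 - x\<^sup>2) = \<tau> + B * p0"
    using sq xy by (simp add: \<tau>_def B_def p0_def divide_simps) algebra
  have eY: "(1 + y\<^sup>2) / (1 - y\<^sup>2) = B' * p0 - \<tau>"
    using sq xy by (simp add: \<tau>_def B'_def p0_def divide_simps) algebra
  have X: "X = \<tau> + B * (p0 - p1)"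
    using eX by (simp add: X_def[folded B_def] algebra_simps)
  have Y: "Y = \<tau> - B' * (p0 - p2)"
    using eY by (simp add: Y_def[folded B'_def] algebra_simps)
  have "Y \<le> \<tau>" using B p by (simp add: Y)
  have *: "\<tau> * (X + Y) - 2 * X * Y = X * (\<tau> - Y) + Y * (\<tau> - X)" by (simp add: algebra_simps)
  have "2 * X * Y \<le> \<tau> * (X + Y) \<and> (p2 < p0 \<longrightarrow> X \<noteq> 0 \<or> Y \<noteq> 0 \<longrightarrow> 2 * X * Y < \<tau> * (X + Y))"
  proof (cases "p0 \<le> p1")
    case True
    then have "X \<le> \<tau>" using B by (simp add: X mult_nonneg_nonpos)
    have "0 \<le> X * (\<tau> - Y)" "0 \<le> Y * (\<tau> - X)"
      using \<open>X \<le> \<tau>\<close> \<open>Y \<le> \<tau>\<close> nn by auto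
    moreover have "0 < X * (\<tau> - Y) + Y * (\<tau> - X)" if "p2 < p0" "X \<noteq> 0 \<or> Y \<noteq> 0"
    proof (cases "X = 0")
      case True
      then show ?thesis using that nn \<open>\<tau> > 0\<close> by simp
    next
      case False
      have "Y < \<tau>" using B that by (simp add: Y)
      then have "0 < X * (\<tau> - Y)" using False nn by simp
      then show ?thesis using \<open>0 \<le> Y * (\<tau> - X)\<close> by linarith
    qed
    ultimately show ?thesis using * by (metis add_nonneg_nonneg diff_ge_0_iff_ge diff_gt_0_iff_gt)
  next
    case False
    define s where "s = p0 - p1"
    have "s > 0" using False by (simp add: s_def)
    have X': "X = \<tau> + B * s" by (simp add: X s_def)
    have "B' * s \<le> B' * (p0 - p2)" using p B by (simp add: s_def)
    then have "Y \<le> \<tau> - B' * s" by (simp add: Y)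
    \<comment> \<open>The claim reads \<open>Y * (2 * X - \<tau>) <= \<tau> * X\<close>; with this
      factor nonnegative, \<open>Y\<close> may be replaced by its upper bound.\<close>
    moreover have "2 * X - \<tau> \<ge> 0" using \<open>\<tau> > 0\<close> B \<open>s > 0\<close> by (simp add: X')
    ultimately have "Y * (2 * X - \<tau>) \<le> (\<tau> - B' * s) * (2 * X - \<tau>)"
      by (rule mult_right_mono)
    also have "\<dots> = \<tau> * X - (\<tau> * (B' - B) * s + 2 * B * B' * s\<^sup>2)"
      by (simp add: X' algebra_simps power2_eq_square)
    also have "\<dots> < \<tau> * X"
    proof -
      have "0 < \<tau> * (B' - B) * s" "0 < 2 * B * B' * s\<^sup>2"
        using B \<open>\<tau> > 0\<close> \<open>s > 0\<close> by simp_all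
      then show ?thesis by linarith
    qed
    finally show ?thesis by (simp add: algebra_simps)
  qed
  then show "2 * X * Y \<le> \<tau> * (X + Y)"
    and "p2 < p0 \<Longrightarrow> X \<noteq> 0 \<or> Y \<noteq> 0 \<Longrightarrow> 2 * X * Y < \<tau> * (X + Y)" by auto
qed

text \<open>Reciprocals need positive slopes. Shifting both by \<open>e\<close> raises the bound on
  their harmonic mean to at most \<open>\<tau> + 2 * e\<close>.\<close>

lemma inverse_sum_ge_of_harmonic:
  fixes X Y \<tau> e :: real
  assumes "X \<ge> 0" "Y \<ge> 0" "\<tau> > 0" "e > 0" "2 * X * Y \<le> \<tau> * (X + Y)"
  shows "2 / (\<tau> + 2 * e) \<le> 1 / (X + e) + 1 / (Y + e)"
proof -
  have "2 * ((X + e) * (Y + e)) \<le> (\<tau> + 2 * e) * (X + Y + 2 * e)"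
  proof -
    have "(\<tau> + 2 * e) * (X + Y + 2 * e) - 2 * ((X + e) * (Y + e))
        = (\<tau> * (X + Y) - 2 * X * Y) + 2 * (\<tau> * e) + 2 * (e * e)"
      by (simp add: algebra_simps)
    moreover have "0 \<le> \<tau> * e" "0 \<le> e * e"
      using assms by simp_all
    ultimately show ?thesis
      using assms(5) by linarith
  qed
  then show ?thesis
    using assms by (simp add: divide_simps) (simp add: algebra_simps)
qed

text \<open>A strict inequality survives a small shift by continuity. If both slopes vanish there is
  no strict inequality to perturb, but then any \<open>e < \<tau>\<close> works.\<close>

lemma ex_inverse_sum_gt_of_harmonic:
  fixes X Y \<tau> :: real
  assumes nn: "X \<ge> 0" "Y \<ge> 0" "\<tau> > 0" and lt: "X \<noteq> 0 \<or> Y \<noteq> 0 \<Longrightarrow> 2 * X * Y < \<tau> * (X + Y)"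
  shows "\<exists>e>0. 2 / \<tau> < 1 / (X + e) + 1 / (Y + e)"
proof -
  have "\<exists>e>0. 2 * ((X + e) * (Y + e)) < \<tau> * (X + Y + 2 * e)"
  proof (cases "X = 0 \<and> Y = 0")
    case True
    then show ?thesis
      using \<open>\<tau> > 0\<close> by (intro exI[of _ "\<tau> / 2"]) auto
  next
    case False
    have "((\<lambda>e. \<tau> * (X + Y + 2 * e) - 2 * ((X + e) * (Y + e))) \<longlongrightarrow> \<tau> * (X + Y) - 2 * X * Y) (at_right 0)"
      by (auto intro!: tendsto_eq_intros)
    then have "\<forall>\<^sub>F e in at_right 0. 0 < \<tau> * (X + Y + 2 * e) - 2 * ((X + e) * (Y + e))"
      using lt False by (intro order_tendstoD) auto
    then have "\<forall>\<^sub>F e in at_right 0. 0 < e \<and> 0 < \<tau> * (X + Y + 2 * e) - 2 * ((X + e) * (Y + e))"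
      using eventually_at_right_less by (rule eventually_elim2) auto
    then show ?thesis
      using eventually_happens'[OF trivial_limit_at_right_real] by fastforce
  qed
  then obtain e where e: "e > 0" "2 * ((X + e) * (Y + e)) < \<tau> * (X + Y + 2 * e)" by auto
  then have "2 / \<tau> < 1 / (X + e) + 1 / (Y + e)"
    using nn by (simp add: divide_simps) (simp add: algebra_simps)
  with e show ?thesis by auto
qed

section \<open>Excursions above a level\<close>

text \<open>\<open>g\<close> stands for \<open>\<rho> / zeta\<close>. With
  \<open>zeta x * w x\<close> factored out, \<open>g\<close> enters only through
  \<open>g - lam * w\<close>, which at level \<open>t\<close> is minus the quantity \<open>p\<close>
  of the harmonic bound.\<close>

locale weighted_logistic_ode =
  fixes a b lam :: real and g w :: "real \<Rightarrow> real"
  assumes ab: "0 < a" "a < b" "b < 1"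
    and g_nonneg: "\<And>x. x \<in> {a..b} \<Longrightarrow> 0 \<le> g x"
    and g_mono: "mono_on {a..b} g"
    and w_lip: "\<exists>L. L-lipschitz_on {a..b} w"
    and ode: "AE x in lborel. x \<in> {a<..<b} \<longrightarrow>
      (w has_real_derivative zeta x * w x * ((1 + x\<^sup>2) / (2 * x) + g x - lam * w x)) (at x)"
begin

lemma w_cont: "continuous_on {a..b} w"
  using w_lip lipschitz_on_continuous_on by blast

end

text \<open>The interval \<open>(x1, x2)\<close> is a connected component of \<open>{w > t}\<close>.\<close>

locale excursion = weighted_logistic_ode +
  fixes x1 x2 t :: real
  assumes x12: "a \<le> x1" "x1 < x2" "x2 \<le> b" and t_pos: "0 < t"
    and w_ends: "w x1 = t" "w x2 = t"
    and w_above: "\<And>x. x1 < x \<Longrightarrow> x < x2 \<Longrightarrow> t < w x"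
begin

text \<open>As \<open>g\<close> is monotone, these are its one-sided limits \<open>g(x1+)\<close> and \<open>g(x2-)\<close>.\<close>

definition "g1 = (INF x\<in>{x1<..<x2}. g x)"
definition "g2 = (SUP x\<in>{x1<..<x2}. g x)"

text \<open>\<open>t * X\<close> and \<open>- t * Y\<close> are the one-sided derivatives of \<open>w\<close> with respect to \<open>ln x\<close> at \<open>x1\<close> and \<open>x2\<close>.\<close>

definition "X = (1 + x1\<^sup>2) / (1 - x1\<^sup>2) - 2 * x1 / (1 - x1\<^sup>2) * (lam * t - g1)"
definition "Y = 2 * x2 / (1 - x2\<^sup>2) * (lam * t - g2) - (1 + x2\<^sup>2) / (1 - x2\<^sup>2)"

lemma in_ab: "x \<in> {x1..x2} \<Longrightarrow> a \<le> x \<and> x \<le> b \<and> 0 < x \<and> x < 1"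
  using x12 ab by auto

lemma g_bdd: "bdd_below (g ` {x1<..<x2})" "bdd_above (g ` {x1<..<x2})"
proof -
  have "g a \<le> g x \<and> g x \<le> g b" if "x \<in> {x1<..<x2}" for x
    using that x12 g_mono by (auto simp: mono_on_def)
  then show "bdd_below (g ` {x1<..<x2})" "bdd_above (g ` {x1<..<x2})"
    by (auto intro!: bdd_belowI2[of _ "g a"] bdd_aboveI2[of _ _ "g b"])
qed

lemma g_bounds:
  assumes "x1 < x" "x < x2"
  shows "g1 \<le> g x" "g x \<le> g2"
  using assms g_bdd unfolding g1_def g2_def by (auto intro: cINF_lower cSUP_upper)

lemma g1_le_g2: "g1 \<le> g2"
  using g_bounds[of "(x1 + x2) / 2"] x12 by auto

lemma g2_nonneg: "0 \<le> g2"
  using g_bounds(2)[of "(x1 + x2) / 2"] g_nonneg[of "(x1 + x2) / 2"] x12 by auto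

lemma ex_left_g_less:
  assumes "g1 < G"
  shows "\<exists>s. x1 < s \<and> s < x2 \<and> (\<forall>x. x1 < x \<longrightarrow> x \<le> s \<longrightarrow> g x < G)"
proof -
  obtain s where s: "s \<in> {x1<..<x2}" "g s < G"
    using assms g_bdd x12 unfolding g1_def by (subst (asm) cINF_less_iff) auto
  have "g x \<le> g s" if "x1 < x" "x \<le> s" for x
    using that s x12 g_mono by (auto simp: mono_on_def)
  with s show ?thesis by fastforce
qed

lemma ex_right_g_greater:
  assumes "G < g2"
  shows "\<exists>s. x1 < s \<and> s < x2 \<and> (\<forall>x. s \<le> x \<longrightarrow> x < x2 \<longrightarrow> G < g x)"
proof -
  obtain s where s: "s \<in> {x1<..<x2}" "G < g s"
    using assms g_bdd x12 unfolding g2_def by (subst (asm) less_cSUP_iff) auto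
  have "g s \<le> g x" if "s \<le> x" "x < x2" for x
    using that s x12 g_mono by (auto simp: mono_on_def)
  with s show ?thesis by fastforce
qed

section \<open>Growth of \<open>w\<close> near the two ends of the component\<close>

lemma w_ge: "x \<in> {x1..x2} \<Longrightarrow> t \<le> w x"
  using w_ends w_above[of x] by (cases "x = x1"; cases "x = x2") auto

lemma w_cont_x12: "continuous_on {x1..x2} w"
  using w_cont x12 by (auto intro: continuous_on_subset)

lemma ode_x12: "AE x in lborel. x \<in> {x1<..<x2} \<longrightarrow>
    (w has_real_derivative zeta x * w x * ((1 + x\<^sup>2) / (2 * x) + g x - lam * w x)) (at x)"
  using ode by eventually_elim (use x12 in auto)

lemma sq_less_1: "x \<in> {x1..x2} \<Longrightarrow> x\<^sup>2 < 1"
  using in_ab[of x] by (simp add: power_less_one_iff)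

text \<open>Multiplication by \<open>x\<close> turns the derivative into the one in
  \<open>ln x\<close>. \<open>G\<close> is kept apart from \<open>g x\<close>, so that for a
  constant \<open>G\<close> the right side is continuous up to the ends.\<close>

lemma speed_eq:
  assumes "x \<in> {x1..x2}"
  shows "x * (zeta x * w x * ((1 + x\<^sup>2) / (2 * x) + G - lam * w x))
    = w x * ((1 + x\<^sup>2) / (1 - x\<^sup>2) + 2 * x / (1 - x\<^sup>2) * (G - lam * w x))"
  using in_ab[OF assms] sq_less_1[OF assms] by (simp add: zeta_def divide_simps) algebra

lemma speed_cont:
  "continuous_on {x1..x2} (\<lambda>x. w x * ((1 + x\<^sup>2) / (1 - x\<^sup>2) + 2 * x / (1 - x\<^sup>2) * (G - lam * w x)))"
  using sq_less_1 by (intro continuous_intros w_cont_x12) force+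

lemma lipschitz_ln_plus_w: "\<exists>L. L-lipschitz_on {x1..x2} (\<lambda>x. k * ln x + c * w x)"
proof -
  obtain L where "L-lipschitz_on {x1..x2} w"
    using w_lip x12 lipschitz_on_subset[of _ "{a..b}" w "{x1..x2}"] by auto
  moreover obtain M where "M-lipschitz_on {x1..x2} (\<lambda>x. k * ln x)"
    using C1_imp_lipschitz_on_Icc[of x1 x2 "\<lambda>x. k * ln x" "\<lambda>x. k / x"] in_ab
    by (force intro!: derivative_eq_intros continuous_intros)
  ultimately show ?thesis
    using lipschitz_on_add lipschitz_on_cmult_real by blast
qed

text \<open>Just right of \<open>x1\<close>, \<open>g\<close> is below some \<open>G\<close>
  slightly above \<open>g1\<close>, and the speed with \<open>G\<close> in place of \<open>g\<close>
  is continuous and less than \<open>k\<close>. Hence \<open>k * ln x - w x\<close> has nonnegative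
  derivative almost everywhere there.\<close>

lemma left_growth:
  assumes "t * X < k"
  shows "\<exists>s. x1 < s \<and> s < x2 \<and> (\<forall>x. x1 \<le> x \<longrightarrow> x \<le> s \<longrightarrow> w x \<le> t + k * ln (x / x1))"
proof -
  have aux: "0 \<le> k / y - D" if "y * D < k" "0 < y" for y D
    using that by (simp add: field_simps)
  let ?\<phi> = "\<lambda>G x. w x * ((1 + x\<^sup>2) / (1 - x\<^sup>2) + 2 * x / (1 - x\<^sup>2) * (G - lam * w x))"
  have "((\<lambda>G. ?\<phi> G x1) \<longlongrightarrow> ?\<phi> g1 x1) (at_right g1)"
    by (intro tendsto_intros)
  moreover have "?\<phi> g1 x1 = t * X"
  proof -
    have "A + B * (g1 - l) = A - B * (l - g1)" for A B l :: real
      by (simp add: algebra_simps)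
    then show ?thesis
      by (simp only: X_def w_ends)
  qed
  then have "?\<phi> g1 x1 < k"
    using assms by simp
  ultimately have "\<forall>\<^sub>F G in at_right g1. ?\<phi> G x1 < k"
    by (rule order_tendstoD)
  then have "\<forall>\<^sub>F G in at_right g1. g1 < G \<and> ?\<phi> G x1 < k"
    using eventually_at_right_less by (rule eventually_elim2) auto
  then obtain G where G: "g1 < G" "?\<phi> G x1 < k"
    using eventually_happens'[OF trivial_limit_at_right_real] by blast
  obtain s1 where s1: "x1 < s1" "s1 < x2" "\<And>x. x1 < x \<Longrightarrow> x \<le> s1 \<Longrightarrow> g x < G"
    using ex_left_g_less[OF G(1)] by blast
  have "(?\<phi> G \<longlongrightarrow> ?\<phi> G x1) (at x1 within {x1..x2})"
    using speed_cont[of G] x12 by (auto simp: continuous_on_def)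
  then have "(?\<phi> G \<longlongrightarrow> ?\<phi> G x1) (at_right x1)"
    by (simp only: at_within_Icc_at_right[OF x12(2)])
  then have "\<forall>\<^sub>F x in at_right x1. ?\<phi> G x < k"
    using G(2) by (rule order_tendstoD)
  then obtain s2 where s2: "x1 < s2" "\<And>x. x1 < x \<Longrightarrow> x < s2 \<Longrightarrow> ?\<phi> G x < k"
    by (auto simp: eventually_at_right_field)
  define s where "s = min s1 ((x1 + s2) / 2)"
  have s: "x1 < s" "s < x2" "s \<le> s1" "s < s2"
    using s1(1,2) s2(1) by (auto simp: s_def min_def max_def)
  have "w x \<le> t + k * ln (x / x1)" if x: "x1 \<le> x" "x \<le> s" for x
  proof -
    obtain L where "L-lipschitz_on {x1..x2} (\<lambda>x. k * ln x + (- 1) * w x)"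
      using lipschitz_ln_plus_w by blast
    then have L: "L-lipschitz_on {x1..x} (\<lambda>x. k * ln x - w x)"
      using x s by (auto intro: lipschitz_on_subset)
    have "k * ln x1 - w x1 \<le> k * ln x - w x"
    proof (rule lipschitz_AE_deriv_nonneg_imp_le[OF L \<open>x1 \<le> x\<close>])
      show "AE y in lborel. y \<in> {x1<..<x} \<longrightarrow>
          (\<exists>D\<ge>0. ((\<lambda>y. k * ln y - w y) has_real_derivative D) (at y))"
        using ode_x12
      proof (eventually_elim, intro impI)
        fix y assume w': "y \<in> {x1<..<x2} \<longrightarrow> (w has_real_derivative zeta y * w y * ((1 + y\<^sup>2) / (2 * y) + g y - lam * w y)) (at y)"
          and "y \<in> {x1<..<x}"
        then have y: "y \<in> {x1<..<x2}" "y \<in> {x1..x2}" "y < s2" "y \<le> s1" "x1 < y"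
          using x s by auto
        let ?D = "zeta y * w y * ((1 + y\<^sup>2) / (2 * y) + g y - lam * w y)"
        have "0 < y" using in_ab[OF y(2)] by simp
        have "y * ?D = ?\<phi> (g y) y"
          using speed_eq[OF y(2)] .
        also have "\<dots> \<le> ?\<phi> G y"
          using s1(3)[of y] y w_ge[OF y(2)] t_pos in_ab[OF y(2)] sq_less_1[OF y(2)]
          by (intro mult_left_mono add_left_mono) auto
        also have "\<dots> < k"
          using s2(2) y by auto
        finally have "0 \<le> k / y - ?D"
          using \<open>0 < y\<close> by (rule aux)
        moreover have "((\<lambda>y. k * ln y - w y) has_real_derivative k / y - ?D) (at y)"
          using w' y \<open>0 < y\<close> by (auto intro!: derivative_eq_intros)
        ultimately show "\<exists>D\<ge>0. ((\<lambda>y. k * ln y - w y) has_real_derivative D) (at y)"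
          by blast
      qed
    qed
    then show ?thesis
      using in_ab[of x1] x x12 by (simp add: w_ends ln_div algebra_simps)
  qed
  with s show ?thesis by blast
qed

text \<open>Mirror image at \<open>x2\<close>: descent is bounded, so \<open>g\<close> is now
  bounded below by some \<open>G < g2\<close>, and \<open>k * ln x + w x\<close> is the
  nondecreasing function.\<close>

lemma right_growth:
  assumes "t * Y < k"
  shows "\<exists>s. x1 < s \<and> s < x2 \<and> (\<forall>x. s \<le> x \<longrightarrow> x \<le> x2 \<longrightarrow> w x \<le> t + k * ln (x2 / x))"
proof -
  have aux: "0 \<le> k / y + D" if "- k < y * D" "0 < y" for y D
    using that by (simp add: field_simps)
  let ?\<phi> = "\<lambda>G x. w x * ((1 + x\<^sup>2) / (1 - x\<^sup>2) + 2 * x / (1 - x\<^sup>2) * (G - lam * w x))"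
  have "((\<lambda>G. ?\<phi> G x2) \<longlongrightarrow> ?\<phi> g2 x2) (at_left g2)"
    by (intro tendsto_intros)
  moreover have "?\<phi> g2 x2 = - (t * Y)"
  proof -
    have "u * (A + B * (g2 - l)) = - (u * (B * (l - g2) - A))" for A B l u :: real
      by (simp add: algebra_simps)
    then show ?thesis
      by (simp only: Y_def w_ends)
  qed
  then have "- k < ?\<phi> g2 x2"
    using assms by simp
  ultimately have "\<forall>\<^sub>F G in at_left g2. - k < ?\<phi> G x2"
    by (rule order_tendstoD)
  then have "\<forall>\<^sub>F G in at_left g2. G < g2 \<and> - k < ?\<phi> G x2"
    using eventually_at_left_real[of "g2 - 1" g2] by (auto elim: eventually_elim2)
  then obtain G where G: "G < g2" "- k < ?\<phi> G x2"
    using eventually_happens'[OF trivial_limit_at_left_real] by blast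
  obtain s1 where s1: "x1 < s1" "s1 < x2" "\<And>x. s1 \<le> x \<Longrightarrow> x < x2 \<Longrightarrow> G < g x"
    using ex_right_g_greater[OF G(1)] by blast
  have "(?\<phi> G \<longlongrightarrow> ?\<phi> G x2) (at x2 within {x1..x2})"
    using speed_cont[of G] x12 by (auto simp: continuous_on_def)
  then have "(?\<phi> G \<longlongrightarrow> ?\<phi> G x2) (at_left x2)"
    by (simp only: at_within_Icc_at_left[OF x12(2)])
  then have "\<forall>\<^sub>F x in at_left x2. - k < ?\<phi> G x"
    using G(2) by (rule order_tendstoD)
  then obtain s2 where s2: "s2 < x2" "\<And>x. s2 < x \<Longrightarrow> x < x2 \<Longrightarrow> - k < ?\<phi> G x"
    by (auto simp: eventually_at_left_field)
  define s where "s = max s1 ((x2 + s2) / 2)"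
  have s: "x1 < s" "s < x2" "s1 \<le> s" "s2 < s"
    using s1(1,2) s2(1) by (auto simp: s_def min_def max_def)
  have "w x \<le> t + k * ln (x2 / x)" if x: "s \<le> x" "x \<le> x2" for x
  proof -
    obtain L where "L-lipschitz_on {x1..x2} (\<lambda>x. k * ln x + 1 * w x)"
      using lipschitz_ln_plus_w by blast
    then have L: "L-lipschitz_on {x..x2} (\<lambda>x. k * ln x + w x)"
      using x s by (auto intro: lipschitz_on_subset)
    have "k * ln x + w x \<le> k * ln x2 + w x2"
    proof (rule lipschitz_AE_deriv_nonneg_imp_le[OF L \<open>x \<le> x2\<close>])
      show "AE y in lborel. y \<in> {x<..<x2} \<longrightarrow>
          (\<exists>D\<ge>0. ((\<lambda>y. k * ln y + w y) has_real_derivative D) (at y))"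
        using ode_x12
      proof (eventually_elim, intro impI)
        fix y assume w': "y \<in> {x1<..<x2} \<longrightarrow> (w has_real_derivative zeta y * w y * ((1 + y\<^sup>2) / (2 * y) + g y - lam * w y)) (at y)"
          and "y \<in> {x<..<x2}"
        then have y: "y \<in> {x1<..<x2}" "y \<in> {x1..x2}" "s2 < y" "s1 \<le> y" "y < x2"
          using x s by auto
        let ?D = "zeta y * w y * ((1 + y\<^sup>2) / (2 * y) + g y - lam * w y)"
        have "0 < y" using in_ab[OF y(2)] by simp
        have "- k < ?\<phi> G y"
          using s2(2) y by auto
        also have "\<dots> \<le> ?\<phi> (g y) y"
          using s1(3)[of y] y w_ge[OF y(2)] t_pos in_ab[OF y(2)] sq_less_1[OF y(2)]
          by (intro mult_left_mono add_left_mono) auto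
        also have "\<dots> = y * ?D"
          using speed_eq[OF y(2), symmetric] .
        finally have "0 \<le> k / y + ?D"
          using \<open>0 < y\<close> by (rule aux)
        moreover have "((\<lambda>y. k * ln y + w y) has_real_derivative k / y + ?D) (at y)"
          using w' y \<open>0 < y\<close> by (auto intro!: derivative_eq_intros)
        ultimately show "\<exists>D\<ge>0. ((\<lambda>y. k * ln y + w y) has_real_derivative D) (at y)"
          by blast
      qed
    qed
    then show ?thesis
      using in_ab[of x2] in_ab[of x] x s x12 by (simp add: w_ends ln_div algebra_simps)
  qed
  with s show ?thesis by blast
qed

lemma X_nonneg: "0 \<le> X"
proof (rule ccontr)
  assume "\<not> 0 \<le> X"
  \<comment> \<open>Half of a negative slope still exceeds it and is still negative, so the growth
    bound would push \<open>w\<close> below \<open>t\<close> inside the component.\<close>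
  then have "t * X < t * X / 2" "t * X / 2 < 0"
    using t_pos by (simp_all add: mult_pos_neg)
  moreover from left_growth[OF this(1)] obtain s where s: "x1 < s" "s < x2" "w s \<le> t + t * X / 2 * ln (s / x1)"
    by (meson less_imp_le order_refl)
  moreover have "0 < ln (s / x1)"
    using s in_ab[of x1] x12 by simp
  ultimately have "t * X / 2 * ln (s / x1) < 0"
    by (intro mult_neg_pos)
  then show False
    using s w_above[of s] by linarith
qed

lemma Y_nonneg: "0 \<le> Y"
proof (rule ccontr)
  assume "\<not> 0 \<le> Y"
  then have "t * Y < t * Y / 2" "t * Y / 2 < 0"
    using t_pos by (simp_all add: mult_pos_neg)
  moreover from right_growth[OF this(1)] obtain s where s: "x1 < s" "s < x2" "w s \<le> t + t * Y / 2 * ln (x2 / s)"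
    by (meson less_imp_le order_refl)
  moreover have "0 < ln (x2 / s)"
    using s in_ab[of x1] x12 by simp
  ultimately have "t * Y / 2 * ln (x2 / s) < 0"
    by (intro mult_neg_pos)
  then show False
    using s w_above[of s] by linarith
qed

text \<open>Inverting the growth bounds, \<open>w\<close> stays at most \<open>t + \<delta>\<close>
  up to \<open>x1 * exp (\<delta> / k1)\<close> and from \<open>x2 * exp (- \<delta> / k2)\<close>
  on. In \<open>dx/x\<close> these strips measure exactly \<open>\<delta> / k1\<close> and
  \<open>\<delta> / k2\<close>.\<close>

lemma mu_fun_local_drop:
  assumes k: "t * X < k1" "t * Y < k2"
  shows "\<forall>\<^sub>F \<delta> in at_right 0. mu_fun a b w (t + \<delta>) + \<delta> * (1 / k1 + 1 / k2) \<le> mu_fun a b w t"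
proof -
  have kpos: "0 < k1" "0 < k2"
    using k X_nonneg Y_nonneg t_pos by (auto intro: le_less_trans[rotated])
  obtain s1 where s1: "x1 < s1" "s1 < x2" "\<And>x. x1 \<le> x \<Longrightarrow> x \<le> s1 \<Longrightarrow> w x \<le> t + k1 * ln (x / x1)"
    using left_growth[OF k(1)] by blast
  obtain s2 where s2: "x1 < s2" "s2 < x2" "\<And>x. s2 \<le> x \<Longrightarrow> x \<le> x2 \<Longrightarrow> w x \<le> t + k2 * ln (x2 / x)"
    using right_growth[OF k(2)] by blast
  have pos: "0 < x1" "0 < x2" using in_ab[of x1] in_ab[of x2] x12 by auto
  \<comment> \<open>The midpoint keeps the two strips disjoint.\<close>
  define m where "m = (x1 + x2) / 2"
  have m: "x1 < m" "m < x2" using x12 by (auto simp: m_def)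
  let ?c = "\<lambda>\<delta>. x1 * exp (\<delta> / k1)" and ?d = "\<lambda>\<delta>. x2 * exp (- \<delta> / k2)"
  have "\<forall>\<^sub>F \<delta> in at_right 0. ?c \<delta> < min s1 m"
  proof (rule order_tendstoD(2))
    show "(?c \<longlongrightarrow> x1 * exp (0 / k1)) (at_right 0)"
      by (intro tendsto_intros) (use kpos in simp)
  qed (use s1 m in simp)
  moreover have "\<forall>\<^sub>F \<delta> in at_right 0. max s2 m < ?d \<delta>"
  proof (rule order_tendstoD(1))
    show "(?d \<longlongrightarrow> x2 * exp (- 0 / k2)) (at_right 0)"
      by (intro tendsto_intros) (use kpos in simp)
  qed (use s2 m in simp)
  moreover have "\<forall>\<^sub>F \<delta> in at_right (0::real). 0 < \<delta>"
    by (rule eventually_at_right_less)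
  ultimately show ?thesis
  proof eventually_elim
    case (elim \<delta>)
    have "1 < exp (\<delta> / k1)" "exp (- \<delta> / k2) < 1" using elim kpos by simp_all
    then have cd: "x1 \<le> ?c \<delta>" "?d \<delta> \<le> x2" using pos by simp_all
    have "mu_fun a b w (t + \<delta>) + (ln (?c \<delta> / x1) + ln (x2 / ?d \<delta>)) \<le> mu_fun a b w t"
    proof (rule mu_fun_drop[OF ab(1) w_cont _ x12(1) cd(1) _ cd(2) x12(3)])
      show "w x \<le> t + \<delta>" if "x1 < x" "x \<le> ?c \<delta>" for x
      proof -
        have "ln (x / x1) \<le> ln (exp (\<delta> / k1))"
          using that pos by (subst ln_le_cancel_iff) (auto simp: field_simps)
        then have "k1 * ln (x / x1) \<le> \<delta>" using kpos by (simp add: field_simps)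
        then show ?thesis using s1(3)[of x] that elim by auto
      qed
      show "w x \<le> t + \<delta>" if "?d \<delta> \<le> x" "x < x2" for x
      proof -
        have "0 < x" using that pos by (auto intro: less_le_trans[rotated])
        have "x2 \<le> exp (\<delta> / k2) * x" using that by (simp add: exp_minus field_simps)
        then have "ln (x2 / x) \<le> ln (exp (\<delta> / k2))"
          using \<open>0 < x\<close> pos by (subst ln_le_cancel_iff) (auto simp: field_simps)
        then have "k2 * ln (x2 / x) \<le> \<delta>" using kpos by (simp add: field_simps)
        then show ?thesis using s2(3)[of x] that elim by auto
      qed
    qed (use elim w_above in auto)
    moreover have "ln (?c \<delta> / x1) = \<delta> / k1" "ln (x2 / ?d \<delta>) = \<delta> / k2"
      using pos by (simp_all add: ln_div)
    ultimately show ?case by (simp add: algebra_simps)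
  qed
qed

text \<open>\<open>1 / u0\<close> solves the equation with \<open>g = 0\<close> and \<open>lam = p0\<close> on \<open>[x1, x2]\<close>, with boundary values 1;
  \<open>J\<close> is an integrating factor for the linear equation of \<open>1 / w\<close> with \<open>g\<close> replaced by \<open>g2\<close>.\<close>

definition "p0 = (1 + x1 * x2) / (x1 + x2)"
definition "u0 x = (x1 * x2 + x\<^sup>2) / ((x1 + x2) * x)"
definition "J x = x / (1 - x\<^sup>2) * exp (g2 * (ln (1 + x) - ln (1 - x)))"

lemma u0_deriv:
  assumes "x \<in> {x1..x2}"
  shows "(u0 has_real_derivative zeta x * (p0 - (1 + x\<^sup>2) / (2 * x) * u0 x)) (at x)"
proof -
  have pos: "0 < x" "0 < x1 + x2" and "1 - x\<^sup>2 \<noteq> 0"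
    using in_ab[of x] in_ab[of x1] in_ab[of x2] x12 assms sq_less_1[OF assms] by auto
  have "(u0 has_real_derivative (2 * x * ((x1 + x2) * x) - (x1 * x2 + x\<^sup>2) * (x1 + x2)) / ((x1 + x2) * x)\<^sup>2) (at x)"
    unfolding u0_def[abs_def] using pos
    by (auto intro!: derivative_eq_intros simp: power2_eq_square)
  also have "(2 * x * ((x1 + x2) * x) - (x1 * x2 + x\<^sup>2) * (x1 + x2)) / ((x1 + x2) * x)\<^sup>2
      = zeta x * (p0 - (1 + x\<^sup>2) / (2 * x) * u0 x)"
    using pos \<open>1 - x\<^sup>2 \<noteq> 0\<close> unfolding u0_def p0_def zeta_def
    by (simp add: divide_simps) algebra
  finally show ?thesis .
qed

lemma u0_ends: "u0 x1 = 1" "u0 x2 = 1"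
  using in_ab[of x1] in_ab[of x2] x12
  by (simp_all add: u0_def divide_eq_1_iff) (simp_all add: power2_eq_square algebra_simps)

text \<open>The gap \<open>1 - u0 x\<close> equals
  \<open>(x - x1) * (x2 - x) / ((x1 + x2) * x)\<close>. It is the source of strictness when
  \<open>g2 > 0\<close>.\<close>

lemma u0_less_1:
  assumes "x1 < x" "x < x2"
  shows "u0 x < 1"
proof -
  have "0 < x1" using in_ab[of x1] x12 by simp
  have "0 < (x - x1) * (x2 - x)"
    using assms by simp
  then show ?thesis
    using assms \<open>0 < x1\<close> by (simp add: u0_def divide_simps power2_eq_square algebra_simps add_pos_pos)
qed

text \<open>The factor \<open>x / (1 - x\<^sup>2)\<close> has logarithmic derivative
  \<open>zeta x * (1 + x\<^sup>2) / (2 * x)\<close>, and the exponential, which is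
  \<open>((1 + x) / (1 - x))\<close> to the power \<open>g2\<close>, has
  \<open>zeta x * g2\<close>.\<close>

lemma J_deriv:
  assumes "x \<in> {x1..x2}"
  shows "(J has_real_derivative J x * zeta x * ((1 + x\<^sup>2) / (2 * x) + g2)) (at x)"
proof -
  have x: "0 < x" "x < 1" "x\<^sup>2 < 1" using in_ab[OF assms] sq_less_1[OF assms] by auto
  let ?E = "exp (g2 * (ln (1 + x) - ln (1 - x)))"
  have "((\<lambda>x. x / (1 - x\<^sup>2)) has_real_derivative (1 + x\<^sup>2) / (1 - x\<^sup>2)\<^sup>2) (at x)"
    using x by (auto intro!: derivative_eq_intros simp: power2_eq_square)
  moreover have "((\<lambda>x. exp (g2 * (ln (1 + x) - ln (1 - x)))) has_real_derivative ?E * (g2 * (1 / (1 + x) + 1 / (1 - x)))) (at x)"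
    using x by (auto intro!: derivative_eq_intros)
  ultimately have "(J has_real_derivative
      (1 + x\<^sup>2) / (1 - x\<^sup>2)\<^sup>2 * ?E + ?E * (g2 * (1 / (1 + x) + 1 / (1 - x))) * (x / (1 - x\<^sup>2))) (at x)"
    unfolding J_def[abs_def] by (rule DERIV_mult)
  also have "1 / (1 + x) + 1 / (1 - x) = 2 / (1 - x\<^sup>2)"
    using x by (simp add: divide_simps) algebra
  also have "(1 + x\<^sup>2) / (1 - x\<^sup>2)\<^sup>2 * ?E + ?E * (g2 * (2 / (1 - x\<^sup>2))) * (x / (1 - x\<^sup>2))
      = J x * zeta x * ((1 + x\<^sup>2) / (2 * x) + g2)"
  proof -
    have "(1 + x\<^sup>2) / q\<^sup>2 * E + E * (g2 * (2 / q)) * (x / q)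
        = x / q * E * (2 / q) * ((1 + x\<^sup>2) / (2 * x) + g2)" if "q \<noteq> 0" for q E
      using x that by (simp add: field_simps power2_eq_square)
    then show ?thesis
      using x unfolding J_def zeta_def by simp
  qed
  finally show ?thesis .
qed

lemma J_pos: "x \<in> {x1..x2} \<Longrightarrow> 0 < J x"
  using in_ab[of x] sq_less_1[of x] by (simp add: J_def)

lemma zeta_pos: "x \<in> {x1..x2} \<Longrightarrow> 0 < zeta x"
  using sq_less_1[of x] by (simp add: zeta_def)

text \<open>Makes the almost-everywhere monotonicity criterion applicable; \<open>w >= t\<close>
  keeps the reciprocal of \<open>w\<close> Lipschitz.\<close>

lemma comparison_lipschitz: "\<exists>L. L-lipschitz_on {x1..x2} (\<lambda>x. J x * (t / w x - u0 x))"
proof -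
  have "0 < x1" using in_ab[of x1] x12 by simp
  have pos: "x \<noteq> 0" "1 - x\<^sup>2 \<noteq> 0" if "x \<in> {x1..x2}" for x
    using in_ab[OF that] sq_less_1[OF that] by auto
  have Jc: "continuous_on {x1..x2} J" and uc: "continuous_on {x1..x2} u0"
    using DERIV_isCont[OF J_deriv] DERIV_isCont[OF u0_deriv]
    by (blast intro: continuous_at_imp_continuous_on)+
  have J: "\<exists>L. L-lipschitz_on {x1..x2} J"
    by (rule C1_imp_lipschitz_on_Icc[OF J_deriv])
      (use pos \<open>0 < x1\<close> in \<open>auto simp: zeta_def intro!: continuous_intros Jc\<close>)
  have u0: "\<exists>L. L-lipschitz_on {x1..x2} u0"
    by (rule C1_imp_lipschitz_on_Icc[OF u0_deriv])
      (use pos \<open>0 < x1\<close> in \<open>auto simp: zeta_def intro!: continuous_intros uc\<close>)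
  have "\<exists>L. L-lipschitz_on {x1..x2} (\<lambda>x. t / w x)"
  proof -
    obtain L where L: "L-lipschitz_on {x1..x2} w"
      using w_lip x12 lipschitz_on_subset[of _ "{a..b}" w "{x1..x2}"] by auto
    have "(L / t)-lipschitz_on {x1..x2} (\<lambda>x. t / w x)"
    proof (rule lipschitz_onI)
      fix x y assume xy: "x \<in> {x1..x2}" "y \<in> {x1..x2}"
      have w: "t \<le> w x" "t \<le> w y" using w_ge xy by auto
      then have "0 < w x" "0 < w y" using t_pos by auto
      then have "\<bar>t / w x - t / w y\<bar> = t * \<bar>w x - w y\<bar> / (w x * w y)"
        using t_pos by (simp add: diff_divide_eq_iff abs_mult abs_divide abs_minus_commute divide_simps flip: right_diff_distrib)
      also have "\<dots> \<le> t * (L * \<bar>x - y\<bar>) / (t * t)"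
        using w t_pos lipschitz_onD[OF L xy] by (intro frac_le mult_mono mult_left_mono) (auto simp: dist_real_def)
      also have "\<dots> = L / t * \<bar>x - y\<bar>" using t_pos by simp
      finally show "dist (t / w x) (t / w y) \<le> L / t * dist x y"
        by (simp add: dist_real_def)
    qed (use t_pos lipschitz_on_nonneg[OF L] in auto)
    then show ?thesis ..
  qed
  with J u0 obtain L1 L2 L3 where "L1-lipschitz_on {x1..x2} J" "L2-lipschitz_on {x1..x2} u0"
    "L3-lipschitz_on {x1..x2} (\<lambda>x. t / w x)"
    by blast
  from lipschitz_on_mult_Icc[OF this(1) lipschitz_on_diff[OF this(3,2)]] show ?thesis .
qed

text \<open>The terms in \<open>(1 + x\<^sup>2) / (2 * x)\<close> cancel. With \<open>g2\<close>
  rather than \<open>g\<close> in \<open>J\<close>, the outer summands are nonnegative inside the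
  component, so only \<open>lam * t - g2 - p0\<close> has an open sign.\<close>

lemma comparison_deriv:
  assumes "x \<in> {x1..x2}"
    and w': "(w has_real_derivative zeta x * w x * ((1 + x\<^sup>2) / (2 * x) + g x - lam * w x)) (at x)"
  shows "((\<lambda>x. J x * (t / w x - u0 x)) has_real_derivative
    J x * zeta x * ((g2 - g x) * (t / w x) + (lam * t - g2 - p0) + g2 * (1 - u0 x))) (at x)"
proof -
  define h where "h = (1 + x\<^sup>2) / (2 * x)"
  define u where "u = t / w x"
  have "w x \<noteq> 0" using w_ge[OF assms(1)] t_pos by simp
  have "((\<lambda>x. t / w x) has_real_derivative - zeta x * (h + g x) * u + zeta x * (lam * t)) (at x)"
    using w'[folded h_def] \<open>w x \<noteq> 0\<close>
    by (auto intro!: derivative_eq_intros simp: u_def field_simps)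
  from DERIV_mult[OF J_deriv[OF assms(1), folded h_def] DERIV_diff[OF this u0_deriv[OF assms(1), folded h_def]]]
  show ?thesis
    by (rule DERIV_cong) (simp add: u_def[symmetric] algebra_simps)
qed

text \<open>\<open>?F\<close> vanishes at both ends. Were the bound false, its derivative would be
  positive almost everywhere, so \<open>?F\<close> would be monotone and hence identically 0, which
  contradicts that positivity.\<close>

lemma p2_bound:
  shows "lam * t - g2 \<le> p0" and "0 < g2 \<Longrightarrow> lam * t - g2 < p0"
proof -
  let ?F = "\<lambda>x. J x * (t / w x - u0 x)"
  let ?D = "\<lambda>x. J x * zeta x * ((g2 - g x) * (t / w x) + (lam * t - g2 - p0) + g2 * (1 - u0 x))"
  have "\<not> (p0 \<le> lam * t - g2 \<and> (p0 < lam * t - g2 \<or> 0 < g2))"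
  proof
    assume asm: "p0 \<le> lam * t - g2 \<and> (p0 < lam * t - g2 \<or> 0 < g2)"
    have D: "0 < ?D x" if "x1 < x" "x < x2" for x
    proof -
      have "0 < J x" "0 < zeta x" "0 < w x"
        using J_pos zeta_pos w_above[of x] t_pos that by auto
      moreover have "0 \<le> (g2 - g x) * (t / w x)"
        using g_bounds(2)[OF that] \<open>0 < w x\<close> t_pos by simp
      moreover have "0 \<le> g2 * (1 - u0 x)" "0 < g2 \<Longrightarrow> 0 < g2 * (1 - u0 x)"
        using g2_nonneg u0_less_1[OF that] by auto
      ultimately have "0 < (g2 - g x) * (t / w x) + (lam * t - g2 - p0) + g2 * (1 - u0 x)"
        using asm by linarith
      then show ?thesis
        using \<open>0 < J x\<close> \<open>0 < zeta x\<close> by simp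
    qed
    have ae: "AE x in lborel. x \<in> {x1<..<x2} \<longrightarrow> (?F has_real_derivative ?D x) (at x)"
      using ode_x12
    proof eventually_elim
      case (elim x)
      show ?case
      proof
        assume x: "x \<in> {x1<..<x2}"
        show "(?F has_real_derivative ?D x) (at x)"
          by (rule comparison_deriv) (use x elim in auto)
      qed
    qed
    obtain L where L: "L-lipschitz_on {x1..x2} ?F"
      using comparison_lipschitz by blast
    have mono: "?F x \<le> ?F y" if "x1 \<le> x" "x \<le> y" "y \<le> x2" for x y
    proof (rule lipschitz_AE_deriv_nonneg_imp_le[OF _ \<open>x \<le> y\<close>])
      show "L-lipschitz_on {x..y} ?F"
        using that by (intro lipschitz_on_subset[OF L]) auto
      show "AE z in lborel. z \<in> {x<..<y} \<longrightarrow> (\<exists>D\<ge>0. (?F has_real_derivative D) (at z))"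
        using ae
      proof eventually_elim
        case (elim z)
        then show ?case
          using D[of z] that by (intro impI exI[of _ "?D z"]) auto
      qed
    qed
    have zero: "?F x = 0" if "x1 \<le> x" "x \<le> x2" for x
      using mono[of x1 x] mono[of x x2] that w_ends u0_ends t_pos by simp
    have "AE x in lborel. x \<notin> {x1<..<x2}"
      using ae
    proof eventually_elim
      case (elim x)
      show ?case
      proof
        assume x: "x \<in> {x1<..<x2}"
        then have "(?F has_real_derivative ?D x) (at x)" using elim by blast
        moreover have "(?F has_real_derivative 0) (at x)"
          by (rule has_field_derivative_transform_within_open[of "\<lambda>x. 0" _ _ "{x1<..<x2}"])
            (use x zero in auto)
        ultimately have "?D x = 0" by (rule DERIV_unique)
        moreover have "0 < ?D x" by (rule D) (use x in auto)
        ultimately show False by (metis less_irrefl)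
      qed
    qed
    then have "{x1<..<x2} \<in> null_sets lborel"
      by (subst (asm) AE_iff_null_sets[symmetric]) auto
    then show False
      using x12 by (simp add: null_sets_def)
  qed
  then show "lam * t - g2 \<le> p0" and "0 < g2 \<Longrightarrow> lam * t - g2 < p0"
    by (auto simp: not_le not_less)
qed

section \<open>Local decay of \<open>t * cosh (N / 2)\<close>\<close>

definition "\<tau> = (x2 - x1) / (x2 + x1)"

lemma tau_pos: "0 < \<tau>"
  using in_ab[of x1] x12 by (simp add: \<tau>_def)

lemma X_Y_harmonic:
  shows "2 * X * Y \<le> \<tau> * (X + Y)"
    and "0 < g2 \<Longrightarrow> X \<noteq> 0 \<or> Y \<noteq> 0 \<Longrightarrow> 2 * X * Y < \<tau> * (X + Y)"
proof -
  have "0 < x1" "x2 < 1" using in_ab[of x1] in_ab[of x2] x12 by auto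
  note * = harmonic_mean_le[OF this(1) x12(2) this(2), of "lam * t - g2" "lam * t - g1", folded X_def Y_def p0_def \<tau>_def,
      OF _ p2_bound(1) X_nonneg Y_nonneg]
  show "2 * X * Y \<le> \<tau> * (X + Y)"
    by (rule *(1)) (use g1_le_g2 in simp)
  show "2 * X * Y < \<tau> * (X + Y)" if "0 < g2" "X \<noteq> 0 \<or> Y \<noteq> 0"
    by (rule *(2)) (use g1_le_g2 that p2_bound(2) in auto)
qed

lemma tanh_half_length: "tanh (ln (x2 / x1) / 2) = \<tau>"
proof -
  have "0 < x1" "0 < x2" using in_ab[of x1] in_ab[of x2] x12 by auto
  then have "ln (x2 / x1) / 2 = ln (sqrt (x2 / x1))"
    by (simp add: ln_sqrt)
  also have "tanh \<dots> = (x2 / x1 - 1) / (x2 / x1 + 1)"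
    using \<open>0 < x1\<close> \<open>0 < x2\<close> by (simp add: tanh_ln_real)
  also have "x2 / x1 - 1 = (x2 - x1) / x1"
    using \<open>0 < x1\<close> by (simp add: field_simps)
  also have "x2 / x1 + 1 = (x2 + x1) / x1"
    using \<open>0 < x1\<close> by (simp add: field_simps)
  also have "(x2 - x1) / x1 / ((x2 + x1) / x1) = \<tau>"
    using \<open>0 < x1\<close> by (simp add: \<tau>_def)
  finally show ?thesis .
qed

lemma mu_fun_ge_length: "ln (x2 / x1) \<le> mu_fun a b w t"
  using ab x12 w_above w_cont by (intro mu_fun_ge_interval) auto

definition "N = mu_fun a b w t"

text \<open>\<open>\<tau>\<close> is \<open>tanh\<close> of half the logarithmic length of this
  component, while \<open>N\<close> measures all components of the superlevel set.\<close>

lemma tau_le_tanh: "\<tau> \<le> tanh (N / 2)"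
  unfolding tanh_half_length[symmetric] N_def using mu_fun_ge_length by simp

lemma N_pos: "0 < N"
  using tau_pos tau_le_tanh by (meson half_gt_zero_iff less_le_trans tanh_real_pos_iff)

text \<open>Bounding \<open>mu_fun\<close> at \<open>t + \<delta>\<close> by the linear function
  \<open>N - \<delta> * \<kappa>\<close> gives a smooth majorant, whose derivative at 0 is the left
  side of \<open>slope\<close>. Here \<open>\<kappa>\<close> is the drop rate for the end slopes
  \<open>t * (X + e)\<close> and \<open>t * (Y + e)\<close>.\<close>

lemma local_growth_aux:
  assumes "e > 0"
    and slope: "cosh (N / 2) - sinh (N / 2) / 2 * (1 / (X + e) + 1 / (Y + e)) < \<eta>"
  shows "\<forall>\<^sub>F \<delta> in at_right 0. (t + \<delta>) * cosh (mu_fun a b w (t + \<delta>) / 2) < t * cosh (N / 2) + \<eta> * \<delta>"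
proof -
  define \<kappa> where "\<kappa> = 1 / (t * (X + e)) + 1 / (t * (Y + e))"
  let ?f = "\<lambda>\<delta>. (t + \<delta>) * cosh ((N - \<delta> * \<kappa>) / 2) - \<eta> * \<delta>"
  have "\<kappa> = (1 / (X + e) + 1 / (Y + e)) / t"
    using t_pos by (simp add: \<kappa>_def add_divide_distrib mult.commute)
  then have "t * \<kappa> = 1 / (X + e) + 1 / (Y + e)"
    using t_pos by simp
  then have neg: "cosh (N / 2) - sinh (N / 2) / 2 * (t * \<kappa>) - \<eta> < 0"
    using slope by simp
  have "(?f has_real_derivative cosh (N / 2) - sinh (N / 2) / 2 * (t * \<kappa>) - \<eta>) (at 0)"
    by (auto intro!: derivative_eq_intros)
  from DERIV_neg_dec_right[OF this neg]
  obtain d where d: "d > 0" "\<And>\<delta>. 0 < \<delta> \<Longrightarrow> \<delta> < d \<Longrightarrow> ?f \<delta> < ?f 0"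
    by auto
  have "\<forall>\<^sub>F \<delta> in at_right 0. 0 < \<delta> \<and> \<delta> < d"
    using eventually_at_right_real[OF d(1)] by (auto elim: eventually_mono)
  moreover have "\<forall>\<^sub>F \<delta> in at_right 0. mu_fun a b w (t + \<delta>) + \<delta> * \<kappa> \<le> mu_fun a b w t"
    unfolding \<kappa>_def using \<open>e > 0\<close> t_pos by (intro mu_fun_local_drop) auto
  ultimately show ?thesis
  proof eventually_elim
    case (elim \<delta>)
    have "0 \<le> mu_fun a b w (t + \<delta>)"
      by (simp add: mu_fun_def)
    then have "cosh (mu_fun a b w (t + \<delta>) / 2) \<le> cosh ((N - \<delta> * \<kappa>) / 2)"
      using elim by (subst cosh_real_nonneg_le_iff) (auto simp: N_def)
    then have "(t + \<delta>) * cosh (mu_fun a b w (t + \<delta>) / 2) \<le> (t + \<delta>) * cosh ((N - \<delta> * \<kappa>) / 2)"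
      using elim t_pos by (intro mult_left_mono) auto
    then show ?case
      using d(2)[of \<delta>] elim by simp
  qed
qed

lemma sinh_div_tau_ge: "cosh (N / 2) \<le> sinh (N / 2) / \<tau>"
proof -
  have "cosh (N / 2) * \<tau> \<le> cosh (N / 2) * tanh (N / 2)"
    using tau_le_tanh by (intro mult_left_mono) auto
  then show ?thesis
    using tau_pos by (simp add: tanh_def field_simps)
qed

text \<open>For small \<open>e\<close>, replacing \<open>\<tau>\<close> by
  \<open>\<tau> + 2 * e\<close> costs less than \<open>\<eta>\<close>.\<close>

lemma local_growth:
  assumes "\<eta> > 0"
  shows "\<forall>\<^sub>F \<delta> in at_right 0. (t + \<delta>) * cosh (mu_fun a b w (t + \<delta>) / 2) < t * cosh (N / 2) + \<eta> * \<delta>"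
proof -
  have "((\<lambda>e. sinh (N / 2) / (\<tau> + 2 * e)) \<longlongrightarrow> sinh (N / 2) / (\<tau> + 2 * 0)) (at_right 0)"
    using tau_pos by (intro tendsto_intros) auto
  moreover have "cosh (N / 2) - \<eta> < sinh (N / 2) / (\<tau> + 2 * 0)"
    using sinh_div_tau_ge assms by simp
  ultimately have "\<forall>\<^sub>F e in at_right 0. cosh (N / 2) - \<eta> < sinh (N / 2) / (\<tau> + 2 * e)"
    by (rule order_tendstoD)
  then have "\<forall>\<^sub>F e in at_right 0. 0 < e \<and> cosh (N / 2) - \<eta> < sinh (N / 2) / (\<tau> + 2 * e)"
    using eventually_at_right_less by (rule eventually_elim2) auto
  then obtain e where e: "0 < e" "cosh (N / 2) - \<eta> < sinh (N / 2) / (\<tau> + 2 * e)"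
    using eventually_happens'[OF trivial_limit_at_right_real] by blast
  have "sinh (N / 2) / 2 * (2 / (\<tau> + 2 * e)) \<le> sinh (N / 2) / 2 * (1 / (X + e) + 1 / (Y + e))"
    using inverse_sum_ge_of_harmonic[OF X_nonneg Y_nonneg tau_pos e(1) X_Y_harmonic(1)] N_pos
    by (intro mult_left_mono) auto
  moreover have "sinh (N / 2) / 2 * (2 / (\<tau> + 2 * e)) = sinh (N / 2) / (\<tau> + 2 * e)"
    by simp
  ultimately have "cosh (N / 2) - sinh (N / 2) / 2 * (1 / (X + e) + 1 / (Y + e)) < \<eta>"
    using e(2) by linarith
  then show ?thesis
    by (rule local_growth_aux[OF e(1)])
qed

text \<open>The strict harmonic bound leaves room for a fixed \<open>e\<close>, so the auxiliary
  lemma applies with \<open>\<eta> = 0\<close>.\<close>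

lemma local_growth_strict:
  assumes "0 < g2"
  shows "\<forall>\<^sub>F \<delta> in at_right 0. (t + \<delta>) * cosh (mu_fun a b w (t + \<delta>) / 2) < t * cosh (N / 2)"
proof -
  obtain e where e: "e > 0" "2 / \<tau> < 1 / (X + e) + 1 / (Y + e)"
    using ex_inverse_sum_gt_of_harmonic[OF X_nonneg Y_nonneg tau_pos X_Y_harmonic(2)[OF assms]] by blast
  have "sinh (N / 2) / 2 * (2 / \<tau>) < sinh (N / 2) / 2 * (1 / (X + e) + 1 / (Y + e))"
    using e N_pos by (intro mult_strict_left_mono) auto
  moreover have "sinh (N / 2) / 2 * (2 / \<tau>) = sinh (N / 2) / \<tau>"
    by simp
  ultimately have "cosh (N / 2) - sinh (N / 2) / 2 * (1 / (X + e) + 1 / (Y + e)) < 0"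
    using sinh_div_tau_ge by linarith
  from local_growth_aux[OF e(1) this] show ?thesis
    by simp
qed

end

section \<open>Comparison with the explicit solution\<close>

text \<open>Only the sum and the product of the endpoints matter. This explains both the constant
  \<open>C\<close> and why \<open>w0\<close> keeps \<open>t * cosh (N / 2)\<close> constant.\<close>

lemma cosh_half_ln_div:
  fixes r s :: real
  assumes "0 < r" "0 < s"
  shows "cosh (ln (s / r) / 2) = (r + s) / (2 * sqrt (r * s))"
proof -
  have "ln (s / r) / 2 = ln (sqrt (s / r))"
    using assms by (simp add: ln_sqrt)
  also have "cosh \<dots> = (sqrt s / sqrt r + sqrt r / sqrt s) / 2"
    using assms by (simp add: cosh_ln_real real_sqrt_divide)
  also have "sqrt s / sqrt r + sqrt r / sqrt s = (s + r) / (sqrt r * sqrt s)"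
    using assms by (simp add: field_simps)
  finally show ?thesis
    by (simp add: real_sqrt_mult ac_simps)
qed

lemma w0_cont:
  assumes "0 < a" "a < b"
  shows "continuous_on {a..b} (w0 a b)"
proof -
  have "x\<^sup>2 + a * b \<noteq> 0" for x
    using assms by (metis add_nonneg_pos mult_pos_pos order.strict_trans less_irrefl zero_le_power2)
  then show ?thesis
    unfolding w0_def[abs_def] by (intro continuous_intros) auto
qed

text \<open>A lower bound for the superlevel set of \<open>w0\<close> is what the comparison needs:
  \<open>l = ln (s / r)\<close>, where \<open>r < s\<close> solve \<open>w0 a b x = t\<close>, so
  that \<open>r * s = a * b\<close> and \<open>r + s = (a + b) / t\<close>.\<close>

lemma mu_fun_w0_ge:
  assumes ab: "0 < a" "a < b" and t: "1 \<le> t" "t < (a + b) / (2 * sqrt (a * b))"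
  shows "\<exists>l\<ge>0. l \<le> mu_fun a b (w0 a b) t \<and> t * cosh (l / 2) = (a + b) / (2 * sqrt (a * b))"
proof -
  \<comment> \<open>Discriminant of \<open>t * x\<^sup>2 - (a + b) * x + t * a * b\<close>.\<close>
  define D where "D = (a + b)\<^sup>2 - 4 * t\<^sup>2 * (a * b)"
  have "2 * t * sqrt (a * b) < a + b"
    using t ab by (simp add: field_simps)
  then have "(2 * t * sqrt (a * b))\<^sup>2 < (a + b)\<^sup>2"
    using t ab by (intro power_strict_mono) auto
  then have "0 < D"
    using ab by (simp add: D_def power_mult_distrib)
  define r where "r = ((a + b) - sqrt D) / (2 * t)"
  define s where "s = ((a + b) + sqrt D) / (2 * t)"
  have "r < s"
    using \<open>0 < D\<close> t by (simp add: r_def s_def divide_strict_right_mono)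
  have sum: "r + s = (a + b) / t"
    using t by (simp add: r_def s_def field_simps)
  have prod: "r * s = a * b"
  proof -
    have "(a + b - sqrt D) * (a + b + sqrt D) = 4 * t\<^sup>2 * (a * b)"
      using \<open>0 < D\<close> by (simp add: algebra_simps power2_eq_square) (simp add: D_def power2_eq_square algebra_simps)
    then show ?thesis
      using t by (simp add: r_def s_def power2_eq_square)
  qed
  have "0 < s"
    using ab t \<open>0 < D\<close> by (simp add: s_def add_pos_pos)
  moreover have "0 < r * s"
    using prod ab by simp
  ultimately have "0 < r"
    by (simp add: zero_less_mult_iff)
  have "a \<le> r"
  proof (rule ccontr)
    assume "\<not> a \<le> r"
    \<comment> \<open>The monic quadratic with roots \<open>r\<close> and \<open>s\<close>,
      evaluated at \<open>a\<close>: it is nonnegative, so \<open>a\<close> is not strictly between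
      the roots; \<open>a\<close> beyond \<open>s\<close> would make the product too small.\<close>
    have "(a - r) * (a - s) = a * a - a * (r + s) + r * s"
      by (simp add: algebra_simps)
    also have "\<dots> = a * (a + b) * (1 - 1 / t)"
      unfolding sum prod by (simp add: algebra_simps add_divide_distrib)
    also have "\<dots> \<ge> 0"
      using ab t by simp
    finally have "s \<le> a"
      using \<open>\<not> a \<le> r\<close> by (simp add: zero_le_mult_iff)
    then have "r * s < a * a"
      using \<open>\<not> a \<le> r\<close> \<open>0 < r\<close> \<open>0 < s\<close> by (intro mult_less_le_imp_less) auto
    also have "\<dots> < a * b"
      using ab by simp
    finally show False
      using prod by simp
  qed
  have "a * s \<le> a * b"
    using \<open>a \<le> r\<close> \<open>0 < s\<close> prod by (metis mult_right_mono less_imp_le)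
  then have "s \<le> b"
    using ab by simp
  have "t < w0 a b x" if "r < x" "x < s" for x
  proof -
    have "0 < (x - r) * (s - x)"
      using that by simp
    also have "\<dots> = (r + s) * x - (x\<^sup>2 + r * s)"
      by (simp add: algebra_simps power2_eq_square)
    finally have "x\<^sup>2 + a * b < (a + b) / t * x"
      by (simp add: sum prod)
    then have "t * (x\<^sup>2 + a * b) < (a + b) * x"
      using t by (simp add: field_simps)
    moreover have "0 < x\<^sup>2 + a * b"
      using ab by (simp add: add_nonneg_pos)
    ultimately show ?thesis
      by (simp add: w0_def pos_less_divide_eq)
  qed
  then have "ln (s / r) \<le> mu_fun a b (w0 a b) t"
    using ab \<open>a \<le> r\<close> \<open>r < s\<close> \<open>s \<le> b\<close> by (intro mu_fun_ge_interval w0_cont) auto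
  moreover have "0 \<le> ln (s / r)"
    using \<open>0 < r\<close> \<open>r < s\<close> by simp
  moreover have "t * cosh (ln (s / r) / 2) = (a + b) / (2 * sqrt (a * b))"
    using t by (simp add: cosh_half_ln_div[OF \<open>0 < r\<close> \<open>0 < s\<close>] sum prod)
  ultimately show ?thesis
    by blast
qed

text \<open>Evaluation at \<open>sqrt (a * b)\<close>, the centre of symmetry in
  \<open>ln x\<close>.\<close>

lemma supnorm_w0_ge:
  assumes "0 < a" "a < b"
  shows "(a + b) / (2 * sqrt (a * b)) \<le> supnorm a b (w0 a b)"
proof -
  let ?m = "sqrt (a * b)"
  have "a * a \<le> a * b" "a * b \<le> b * b"
    using assms by simp_all
  then have "?m \<in> {a..b}"
    using assms by (auto intro!: real_le_rsqrt real_le_lsqrt simp: power2_eq_square)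
  moreover have "bdd_above ((\<lambda>x. \<bar>w0 a b x\<bar>) ` {a..b})"
    using assms by (intro compact_imp_bounded[THEN bounded_imp_bdd_above] compact_continuous_image continuous_intros w0_cont) auto
  ultimately have "\<bar>w0 a b ?m\<bar> \<le> supnorm a b (w0 a b)"
    unfolding supnorm_def by (intro cSUP_upper)
  moreover have "w0 a b ?m = (a + b) / (2 * ?m)"
    using assms by (simp add: w0_def power2_eq_square[of ?m] field_simps)
  ultimately show ?thesis
    using abs_ge_self[of "w0 a b ?m"] by linarith
qed

section \<open>From local decay to the global comparison\<close>

context weighted_logistic_ode
begin

lemma ex_excursion:
  assumes "w a \<le> t" "w b \<le> t" "0 < t" and z: "z \<in> {a..b}" "t < w z"
  shows "\<exists>x1 x2. excursion a b lam g w x1 x2 t"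
proof -
  define S where "S = {x \<in> {a..z}. w x \<le> t}"
  define R where "R = {x \<in> {z..b}. w x \<le> t}"
  have cont: "continuous_on {a..z} w" "continuous_on {z..b} w"
    using w_cont z by (auto intro: continuous_on_subset)
  have "closed S" "closed R"
    unfolding S_def R_def using cont by (intro continuous_on_closed_Collect_le continuous_intros; simp)+
  have S: "a \<in> S" "bdd_above S" and R: "b \<in> R" "bdd_below R"
    using assms by (auto simp: S_def R_def)
  define x1 where "x1 = Sup S"
  define x2 where "x2 = Inf R"
  have "x1 \<in> S" "x2 \<in> R"
    unfolding x1_def x2_def using S R \<open>closed S\<close> \<open>closed R\<close>
    by (auto intro: closed_contains_Sup closed_contains_Inf)
  then have x1: "a \<le> x1" "x1 < z" "w x1 \<le> t" and x2: "z < x2" "x2 \<le> b" "w x2 \<le> t"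
    using z by (auto simp: S_def R_def order_less_le)
  have left: "t < w x" if "x1 < x" "x \<le> z" for x
  proof (rule ccontr)
    assume "\<not> t < w x"
    then have "x \<in> S" using that x1 by (simp add: S_def)
    then have "x \<le> x1" unfolding x1_def using S(2) by (rule cSup_upper)
    then show False using that by simp
  qed
  have right: "t < w x" if "z \<le> x" "x < x2" for x
  proof (rule ccontr)
    assume "\<not> t < w x"
    then have "x \<in> R" using that x2 by (simp add: R_def)
    then have "x2 \<le> x" unfolding x2_def using R(2) by (rule cInf_lower)
    then show False using that by simp
  qed
  obtain y where "x1 \<le> y" "y \<le> z" "w y = t"
    using IVT'[of w x1 t z] x1 z continuous_on_subset[OF cont(1), of "{x1..z}"] by auto
  then have "w x1 = t" using left[of y] by (cases "y = x1") auto
  obtain y' where "z \<le> y'" "y' \<le> x2" "w y' = t"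
    using IVT2'[of w x2 t z] x2 z continuous_on_subset[OF cont(2), of "{z..x2}"] by auto
  then have "w x2 = t" using right[of y'] by (cases "y' = x2") auto
  have "excursion a b lam g w x1 x2 t"
  proof unfold_locales
    show "t < w x" if "x1 < x" "x < x2" for x
      using that left right by (cases "x \<le> z") auto
  qed (use x1 x2 \<open>0 < t\<close> \<open>w x1 = t\<close> \<open>w x2 = t\<close> in auto)
  then show ?thesis by blast
qed

definition "C = (a + b) / (2 * sqrt (a * b))"

abbreviation "\<Phi> t \<equiv> t * cosh (mu_fun a b w t / 2)"

lemma cosh_mu_fun_antimono:
  assumes "s \<le> t"
  shows "cosh (mu_fun a b w t / 2) \<le> cosh (mu_fun a b w s / 2)"
  using mu_fun_antimono[OF ab(1) w_cont assms]
  by (subst cosh_real_nonneg_le_iff) (auto simp: mu_fun_def)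

text \<open>The whole interval has measure \<open>ln (b / a)\<close>, and
  \<open>C = cosh (ln (b / a) / 2)\<close>. Used as the starting value at level 1 and as the crude
  growth constant \<open>K\<close>.\<close>

lemma cosh_mu_fun_le_C: "cosh (mu_fun a b w t / 2) \<le> C"
proof -
  have "mu_fun a b w t \<le> measure mu {a..b}"
    unfolding mu_fun_def using ab
    by (intro measure_mono_fmeasurable fmeasurable_mu[of a _ b]) (use superlevel_set_borel[OF w_cont, of t] in auto)
  also have "\<dots> = ln (b / a)"
    using ab by (intro measure_mu_interval) (simp_all add: greaterThanLessThan_subseteq_atLeastAtMost_iff)
  finally have "cosh (mu_fun a b w t / 2) \<le> cosh (ln (b / a) / 2)"
    using ab by (subst cosh_real_nonneg_le_iff) (auto simp: mu_fun_def)
  then show ?thesis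
    using ab by (simp add: cosh_half_ln_div C_def)
qed

text \<open>Every level \<open>s\<close> in \<open>[1, t)\<close> is exceeded at \<open>z\<close>,
  so a component exists there and supplies the right-hand growth bound. Upward jumps are excluded
  because \<open>N\<close> is antimonotone: only the factor \<open>t\<close> can make
  \<open>\<Phi>\<close> rise.\<close>

lemma \<Phi>_le_C:
  assumes bc: "w a = 1" "w b = 1" and t: "1 \<le> t" and z: "z \<in> {a..b}" "t < w z"
  shows "\<Phi> t \<le> C"
proof -
  have "\<Phi> t \<le> \<Phi> 1"
  proof (rule right_local_growth_imp_le[OF t])
    show "0 \<le> C" using ab by (simp add: C_def)
    show "\<Phi> s \<le> \<Phi> r + C * (s - r)" if "1 \<le> r" "r \<le> s" "s \<le> t" for r s
    proof -
      have "\<Phi> s \<le> s * cosh (mu_fun a b w r / 2)"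
        using that cosh_mu_fun_antimono[of r s] by (intro mult_left_mono) auto
      also have "\<dots> = \<Phi> r + cosh (mu_fun a b w r / 2) * (s - r)"
        by (simp add: algebra_simps)
      also have "\<dots> \<le> \<Phi> r + C * (s - r)"
        using that cosh_mu_fun_le_C by (intro add_left_mono mult_right_mono) auto
      finally show ?thesis .
    qed
    show "\<forall>\<^sub>F \<delta> in at_right 0. \<Phi> (s + \<delta>) \<le> \<Phi> s + \<eta> * \<delta>" if "1 \<le> s" "s < t" "\<eta> > 0" for s \<eta>
    proof -
      obtain x1 x2 where "excursion a b lam g w x1 x2 s"
        using ex_excursion[of s z] bc \<open>1 \<le> s\<close> less_trans[OF \<open>s < t\<close> z(2)] z(1) by auto
      then interpret excursion a b lam g w x1 x2 s .
      show ?thesis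
        using local_growth[OF \<open>\<eta> > 0\<close>] unfolding N_def by eventually_elim simp
    qed
  qed
  then show ?thesis
    using cosh_mu_fun_le_C[of 1] by simp
qed

text \<open>At any level \<open>t >= 1\<close> that \<open>w\<close> exceeds,
  \<open>cosh >= 1\<close> gives \<open>t <= \<Phi> t <= C\<close>; a level between \<open>C\<close>
  and \<open>w z\<close> is then impossible.\<close>

lemma w_le_C:
  assumes bc: "w a = 1" "w b = 1" and z: "z \<in> {a..b}"
  shows "w z \<le> C"
proof (rule ccontr)
  assume "\<not> w z \<le> C"
  have "1 \<le> C"
    using cosh_mu_fun_le_C[of 1] cosh_real_ge_1 order_trans by blast
  define t where "t = (C + w z) / 2"
  have t: "1 \<le> t" "C < t" "t < w z"
    using \<open>\<not> w z \<le> C\<close> \<open>1 \<le> C\<close> by (auto simp: t_def)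
  have "t * 1 \<le> \<Phi> t"
    using t by (intro mult_left_mono cosh_real_ge_1) auto
  also have "\<dots> \<le> C"
    by (rule \<Phi>_le_C[OF bc t(1) z t(3)])
  finally show False
    using t by simp
qed

text \<open>Both sides are compared through \<open>\<Phi> t <= C = t * cosh (l / 2)\<close>, and
  \<open>cosh\<close> is increasing on nonnegative reals. The existence of \<open>l\<close> needs
  \<open>t < C\<close>, which follows from \<open>t < w z <= C\<close>.\<close>

lemma mu_fun_le_w0:
  assumes bc: "w a = 1" "w b = 1" and t: "1 \<le> t" and z: "z \<in> {a..b}" "t < w z"
  shows "mu_fun a b w t \<le> mu_fun a b (w0 a b) t"
    and "\<Phi> t < C \<Longrightarrow> mu_fun a b w t < mu_fun a b (w0 a b) t"
proof -
  obtain l where l: "l \<ge> 0" "l \<le> mu_fun a b (w0 a b) t" "t * cosh (l / 2) = C"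
    using mu_fun_w0_ge[OF ab(1,2) t, folded C_def] z w_le_C[OF bc z(1)] by auto
  have nn: "0 \<le> mu_fun a b w t / 2" "0 \<le> l / 2"
    using l by (simp_all add: mu_fun_def)
  have "cosh (mu_fun a b w t / 2) \<le> cosh (l / 2)"
    using \<Phi>_le_C[OF bc t z] t unfolding l(3)[symmetric] by simp
  then show "mu_fun a b w t \<le> mu_fun a b (w0 a b) t"
    using l(2) unfolding cosh_real_nonneg_le_iff[OF nn] by simp
  assume "\<Phi> t < C"
  then have "cosh (mu_fun a b w t / 2) < cosh (l / 2)"
    using t unfolding l(3)[symmetric] by simp
  then show "mu_fun a b w t < mu_fun a b (w0 a b) t"
    using l(2) unfolding cosh_real_nonneg_less_iff[OF nn] by simp
qed

text \<open>At level 1 the component is all of \<open>(a, b)\<close>, so a nonzero value of the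
  monotone \<open>g\<close> before \<open>b\<close> forces \<open>g2 > 0\<close> and strict decay
  starts at once.\<close>

lemma \<Phi>_less_C_near_1:
  assumes bc: "w a = 1" "w b = 1" and w_gt: "\<And>x. x \<in> {a<..<b} \<Longrightarrow> w x > 1"
    and nz: "x0 \<in> {a..<b}" "g x0 \<noteq> 0"
  shows "\<forall>\<^sub>F \<delta> in at_right 0. \<Phi> (1 + \<delta>) < C"
proof -
  interpret excursion a b lam g w a b 1
    by unfold_locales (use ab bc w_gt in auto)
  have "0 < g x0"
    using g_nonneg[of x0] nz by simp
  \<comment> \<open>\<open>x0\<close> may equal \<open>a\<close>; the midpoint with \<open>b\<close>
    moves into the open interval over which \<open>g2\<close> is the supremum.\<close>
  also have "g x0 \<le> g ((x0 + b) / 2)"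
    using nz g_mono by (auto simp: mono_on_def)
  also have "\<dots> \<le> g2"
    using nz by (intro g_bounds(2)) auto
  finally have "0 < g2" .
  show ?thesis
    using local_growth_strict[OF \<open>0 < g2\<close>]
    by eventually_elim (use cosh_mu_fun_le_C[of 1] in \<open>simp add: N_def\<close>)
qed

end

theorem mainTheorem14:
  fixes a b lam :: real and \<rho> w :: "real \<Rightarrow> real"
  assumes ab: "0 < a" "a < b" "b < 1"
    and rho_nonneg: "\<forall>x\<in>{a..b}. \<rho> x \<ge> 0"
    and rho_mono: "mono_on {a..b} (\<lambda>x. \<rho> x / zeta x)"
    and rho_bdd: "bounded ((\<lambda>x. \<rho> x / zeta x) ` {a..b})"
    and w_lip: "\<exists>L. L-lipschitz_on {a..b} w"
    and ode: "AE x in lborel. x \<in> {a<..<b} \<longrightarrow>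
               (\<exists>D. (w has_real_derivative D) (at x) \<and>
                    D + lam * zeta x * (w x)^2 = (1 / x + rho_tilde \<rho> x) * w x)"
    and bc: "w a = 1" "w b = 1"
    and w_gt: "\<forall>x\<in>{a<..<b}. w x > 1"
  defines "T \<equiv> min (supnorm a b (w0 a b)) (supnorm a b w)"
  shows "(\<forall>t\<in>{1..<T}. mu_fun a b w t \<le> mu_fun a b (w0 a b) t)
       \<and> supnorm a b w \<le> supnorm a b (w0 a b)
       \<and> ((\<exists>x\<in>{a..<b}. \<rho> x \<noteq> 0) \<longrightarrow>
            (\<exists>t0\<in>{1<..<supnorm a b w}. \<forall>t\<in>{1<..<t0}.
                 mu_fun a b w t < mu_fun a b (w0 a b) t))"
proof -
  have zeta: "0 < zeta x" if "x \<in> {a..b}" for x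
    using that ab by (auto simp: zeta_def power_less_one_iff)
  interpret weighted_logistic_ode a b lam "\<lambda>x. \<rho> x / zeta x" w
  proof unfold_locales
    show "0 \<le> \<rho> x / zeta x" if "x \<in> {a..b}" for x
      using that rho_nonneg zeta[OF that] by simp
    show "AE x in lborel. x \<in> {a<..<b} \<longrightarrow>
      (w has_real_derivative zeta x * w x * ((1 + x\<^sup>2) / (2 * x) + \<rho> x / zeta x - lam * w x)) (at x)"
      using ode
    proof eventually_elim
      case (elim x)
      show ?case
      proof
        assume "x \<in> {a<..<b}"
        with elim obtain D where D: "(w has_real_derivative D) (at x)"
          "D + lam * zeta x * (w x)\<^sup>2 = (1 / x + rho_tilde \<rho> x) * w x" by blast
        have x: "0 < x" "x\<^sup>2 < 1" "zeta x \<noteq> 0"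
          using \<open>x \<in> {a<..<b}\<close> ab zeta[of x] by (auto simp: power_less_one_iff)
        \<comment> \<open>This identity lets \<open>zeta\<close> be factored out of the whole
          right-hand side.\<close>
        have "1 / x + x * zeta x = zeta x * ((1 + x\<^sup>2) / (2 * x))"
          using x(1,2) by (simp add: zeta_def divide_simps) algebra
        then have "1 / x + rho_tilde \<rho> x = zeta x * ((1 + x\<^sup>2) / (2 * x) + \<rho> x / zeta x)"
          using x(3) by (simp add: rho_tilde_def distrib_left)
        with D(2) have "D + lam * zeta x * (w x)\<^sup>2 = zeta x * ((1 + x\<^sup>2) / (2 * x) + \<rho> x / zeta x) * w x"
          by simp
        moreover have "D = z * v * (k - lam * v)" if "D + lam * z * v\<^sup>2 = z * k * v" for z v k :: real
          using that by (simp add: algebra_simps power2_eq_square)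
        ultimately have "D = zeta x * w x * ((1 + x\<^sup>2) / (2 * x) + \<rho> x / zeta x - lam * w x)"
          by blast
        with D(1) show "(w has_real_derivative zeta x * w x * ((1 + x\<^sup>2) / (2 * x) + \<rho> x / zeta x - lam * w x)) (at x)"
          by simp
      qed
    qed
  qed (use ab rho_mono w_lip in auto)
  have abs_w: "\<bar>w x\<bar> = w x" if "x \<in> {a..b}" for x
  proof -
    have "0 \<le> w x"
    proof -
      consider "x = a" | "x = b" | "x \<in> {a<..<b}"
        using \<open>x \<in> {a..b}\<close> by fastforce
      then show ?thesis
        using bc w_gt by cases (auto intro: order.trans[OF zero_le_one less_imp_le])
    qed
    then show ?thesis by simp
  qed
  then have sup_w: "supnorm a b w = (SUP x\<in>{a..b}. w x)"
    unfolding supnorm_def by (intro SUP_cong) auto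
  have bdd: "bdd_above (w ` {a..b})"
    using w_le_C[OF bc] by (auto intro!: bdd_aboveI2[of _ _ C])
  have ex_z: "\<exists>z\<in>{a..b}. t < w z" if "t < supnorm a b w" for t
    using that bdd ab unfolding sup_w by (subst (asm) less_cSUP_iff) auto
  have "supnorm a b w \<le> C"
    unfolding sup_w using w_le_C[OF bc] ab by (intro cSUP_least) auto
  then have ii: "supnorm a b w \<le> supnorm a b (w0 a b)"
    using supnorm_w0_ge[OF ab(1,2), folded C_def] by linarith
  have i: "mu_fun a b w t \<le> mu_fun a b (w0 a b) t" if "1 \<le> t" "t < T" for t
    using ex_z[of t] mu_fun_le_w0(1)[OF bc] that by (auto simp: T_def)
  have iii: "\<exists>t0\<in>{1<..<supnorm a b w}. \<forall>t\<in>{1<..<t0}. mu_fun a b w t < mu_fun a b (w0 a b) t"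
    if nz: "x0 \<in> {a..<b}" "\<rho> x0 \<noteq> 0" for x0
  proof -
    have "\<forall>\<^sub>F \<delta> in at_right 0. \<Phi> (1 + \<delta>) < C"
      by (rule \<Phi>_less_C_near_1[OF bc _ nz(1)]) (use w_gt nz zeta[of x0] in auto)
    then obtain d where d: "d > 0" "\<And>\<delta>. 0 < \<delta> \<Longrightarrow> \<delta> < d \<Longrightarrow> \<Phi> (1 + \<delta>) < C"
      by (auto simp: eventually_at_right_field)
    have "w ((a + b) / 2) \<le> supnorm a b w"
      unfolding sup_w using ab bdd by (intro cSUP_upper) auto
    moreover have "1 < w ((a + b) / 2)"
      using w_gt ab by auto
    ultimately have "1 < supnorm a b w" by simp
    \<comment> \<open>Below \<open>1 + d\<close> the decay is strict; the midpoint keeps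
      \<open>t0\<close> strictly under the sup norm, so that \<open>w\<close> exceeds every level
      before \<open>t0\<close>.\<close>
    define t0 where "t0 = min (1 + d) ((1 + supnorm a b w) / 2)"
    have t0: "1 < t0" "t0 < supnorm a b w" "t0 \<le> 1 + d"
      using \<open>d > 0\<close> \<open>1 < supnorm a b w\<close> by (auto simp: t0_def min_def)
    have "mu_fun a b w t < mu_fun a b (w0 a b) t" if t: "1 < t" "t < t0" for t
    proof -
      obtain z where "z \<in> {a..b}" "t < w z"
        using ex_z[of t] t t0 by auto
      moreover have "\<Phi> t < C"
        using d(2)[of "t - 1"] t t0 by simp
      ultimately show ?thesis
        using mu_fun_le_w0(2)[OF bc, of t z] t by simp
    qed
    then show ?thesis
      using t0 by (intro bexI[of _ t0]) auto
  qed
  show ?thesis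
    using i ii iii by auto
qed

end
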